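(* Let $G$ be a finite graph, let $C^i_G(\lambda)$ ($i\ge 0$) be its impropriety polynomials and let $H^{k,i,j}(G)$ be its dichromatic homology groups. Then for every $i\ge 0$, $$C^{i}_{G}(\lambda) = (-1)^{i} \sum_{j} (\lambda-1)^{j}\, \chi (H^{\star, i, j}(G)),$$ where $\chi(H^{\star,i,j}(G))=\sum_k(-1)^k\operatorname{rank}H^{k,i,j}(G)$.
   Context: $G$ is a finite graph (multiple edges and loops allowed). Impropriety polynomials: $C^i_G(\lambda)$ is the polynomial in $\lambda$ whose value at each positive integer $n$ is the number of colorings of the nodes of $G$ with $n$ colors (arbitrary assignments of one of $n$ colors to each node) such that exactly $i$ edges of $G$ have both ends of the same color (a loop always counts as such an edge). A subgraph $S$ of $G$ here always consists of all nodes of $G$ together with a subset of the edges of $G$. Refined enhanced states: a refined enhanced state $s$ is a subgraph $S$ together with a labeling of each connected component of $S$ by $1$ or $x$, and an independent labeling of each edge of $S$ by $1$ or $y$. Component labels are regarded as elements of the ring $\mathbb{Z}[x]/(x^2)$; edge labels $1,y$ are merely formal markers. For such $s$, $e(s)$ is the number of edges, $i(s)$ the number of edges labeled $y$, and $j(s)$ the number of components labeled $x$. Dichromatic complex: $C^{k,i,j}(G)$ is the free abelian group on the refined enhanced states $s$ with $e(s)=k$, $i(s)=i$, $j(s)=j$. For an edge $e$ of $G$ not in $s$, the partial differential $\partial_e(s)$ is the state obtained from $s$ by adding the edge $e$ with edge label $1$, keeping all other edge labels, and labeling components as follows: if the ends of $e$ lie in two different components of $s$ with labels $a,b$, the merged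 component gets label $ab\in\mathbb{Z}[x]/(x^2)$ (and $\partial_e(s)=0$ if $ab=0$, i.e. $a=b=x$); if the ends of $e$ lie in a single component with label $a$, that component keeps label $a$; all other components keep their labels. Fix an ordering of the edges of $G$ and let $d(s)=\sum_{e\in G-s}(-1)^{n(e)}\partial_e(s)$, the sum over edges $e$ of $G$ not in $s$, where $n(e)$ is the number of edges in $s$ that precede $e$. Then $d:C^{k,i,j}(G)\to C^{k+1,i,j}(G)$, $d^2=0$, and $H^{k,i,j}(G)$ denotes the kernel of $d$ on $C^{k,i,j}(G)$ modulo the image of $d$ from $C^{k-1,i,j}(G)$. *)

theory Defs
  imports
    "HOL-Library.Uprod"
    "HOL-Computational_Algebra.Polynomial"
    "HOL-Algebra.Free_Abelian_Groups"
begin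

section \<open>Finite graphs with multiple edges and loops\<close>

text \<open>A loop at \<open>u\<close> is an edge with ends \<open>Upair u u\<close>.\<close>

record ('v, 'e) multigraph =
  nodes :: "'v set"
  edges :: "'e set"
  ends :: "'e \<Rightarrow> 'v uprod"

definition finite_multigraph :: "('v, 'e) multigraph \<Rightarrow> bool" where
  "finite_multigraph G \<longleftrightarrow>
     finite (nodes G) \<and> finite (edges G) \<and> (\<forall>e\<in>edges G. set_uprod (ends G e) \<subseteq> nodes G)"

text \<open>A spanning subgraph is given by its set \<open>S\<close> of edges; a component is given by its set of
  nodes.\<close>

definition adjacency :: "('v, 'e) multigraph \<Rightarrow> 'e set \<Rightarrow> ('v \<times> 'v) set" where
  "adjacency G S = {(u, v). \<exists>e\<in>S. ends G e = Upair u v}"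

definition component_of :: "('v, 'e) multigraph \<Rightarrow> 'e set \<Rightarrow> 'v \<Rightarrow> 'v set" where
  "component_of G S u = {v \<in> nodes G. (u, v) \<in> (adjacency G S)\<^sup>*}"

definition components_of :: "('v, 'e) multigraph \<Rightarrow> 'e set \<Rightarrow> 'v set set" where
  "components_of G S = component_of G S ` nodes G"


section \<open>Impropriety polynomials\<close>

definition monochromatic :: "('v, 'e) multigraph \<Rightarrow> ('v \<Rightarrow> nat) \<Rightarrow> 'e \<Rightarrow> bool" where
  "monochromatic G f e \<longleftrightarrow> (\<exists>c. map_uprod f (ends G e) = Upair c c)"

definition improper_colorings :: "('v, 'e) multigraph \<Rightarrow> nat \<Rightarrow> nat \<Rightarrow> ('v \<Rightarrow> nat) set" where
  "improper_colorings G i n =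
     {f \<in> nodes G \<rightarrow>\<^sub>E {..<n}. card {e \<in> edges G. monochromatic G f e} = i}"

definition impropriety_poly :: "('v, 'e) multigraph \<Rightarrow> nat \<Rightarrow> int poly" where
  "impropriety_poly G i =
     (THE p. \<forall>n\<ge>1. poly p (int n) = int (card (improper_colorings G i n)))"


section \<open>Refined enhanced states\<close>

datatype comp_label = CompOne | CompX

datatype edge_label = EdgeOne | EdgeY

text \<open>The product of two component labels in \<open>\<int>[x]/(x\<^sup>2)\<close>; \<open>None\<close> stands for the value \<open>0\<close>.\<close>

fun label_mult :: "comp_label \<Rightarrow> comp_label \<Rightarrow> comp_label option" where
  "label_mult CompOne b = Some b"
| "label_mult a CompOne = Some a"
| "label_mult CompX CompX = None"

record ('v, 'e) state =
  sedges :: "'e set"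
  clabel :: "'v set \<Rightarrow> comp_label option"
  elabel :: "'e \<Rightarrow> edge_label option"

definition states :: "('v, 'e) multigraph \<Rightarrow> ('v, 'e) state set" where
  "states G = {s. sedges s \<subseteq> edges G \<and> dom (clabel s) = components_of G (sedges s)
                  \<and> dom (elabel s) = sedges s}"

definition states_at :: "('v, 'e) multigraph \<Rightarrow> nat \<Rightarrow> nat \<Rightarrow> nat \<Rightarrow> ('v, 'e) state set" where
  "states_at G k i j =
     {s \<in> states G. card (sedges s) = k
        \<and> card {e \<in> sedges s. elabel s e = Some EdgeY} = i
        \<and> card {A \<in> components_of G (sedges s). clabel s A = Some CompX} = j}"


section \<open>The dichromatic complex\<close>

definition dichromatic_chains ::
    "('v, 'e) multigraph \<Rightarrow> nat \<Rightarrow> nat \<Rightarrow> nat \<Rightarrow> (('v, 'e) state \<Rightarrow>\<^sub>0 int) monoid" where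
  "dichromatic_chains G k i j = free_Abelian_group (states_at G k i j)"

text \<open>The two ends of an edge in some order. The order is immaterial, as \<open>label_mult\<close> is
  commutative.\<close>

definition end_pair :: "('v, 'e) multigraph \<Rightarrow> 'e \<Rightarrow> 'v \<times> 'v" where
  "end_pair G e = (SOME (u, v). ends G e = Upair u v)"

definition partial_differential ::
    "('v, 'e) multigraph \<Rightarrow> 'e \<Rightarrow> ('v, 'e) state \<Rightarrow> ('v, 'e) state \<Rightarrow>\<^sub>0 int" where
  "partial_differential G e s =
     (let (u, v) = end_pair G e;
          A = component_of G (sedges s) u;
          B = component_of G (sedges s) v;
          extended = (\<lambda>cl. \<lparr>sedges = insert e (sedges s), clabel = cl,
                           elabel = (elabel s)(e \<mapsto> EdgeOne)\<rparr>)
      in if A = B then frag_of (extended (clabel s))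
         else (case label_mult (the (clabel s A)) (the (clabel s B)) of
                 None \<Rightarrow> 0
               | Some c \<Rightarrow> frag_of (extended ((clabel s)(A := None, B := None, A \<union> B \<mapsto> c)))))"

text \<open>The ordering of the edges is a (reflexive) linear order \<open>r\<close> on \<^term>\<open>edges G\<close>.\<close>

definition state_differential ::
    "('v, 'e) multigraph \<Rightarrow> 'e rel \<Rightarrow> ('v, 'e) state \<Rightarrow> ('v, 'e) state \<Rightarrow>\<^sub>0 int" where
  "state_differential G r s =
     (\<Sum>e \<in> edges G - sedges s.
        frag_cmul ((- 1) ^ card {f \<in> sedges s. (f, e) \<in> r}) (partial_differential G e s))"

definition differential ::
    "('v, 'e) multigraph \<Rightarrow> 'e rel \<Rightarrow> (('v, 'e) state \<Rightarrow>\<^sub>0 int) \<Rightarrow> ('v, 'e) state \<Rightarrow>\<^sub>0 int" where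
  "differential G r = frag_extend (state_differential G r)"

definition dichromatic_cycles ::
    "('v, 'e) multigraph \<Rightarrow> 'e rel \<Rightarrow> nat \<Rightarrow> nat \<Rightarrow> nat \<Rightarrow> (('v, 'e) state \<Rightarrow>\<^sub>0 int) set" where
  "dichromatic_cycles G r k i j =
     kernel (dichromatic_chains G k i j) (dichromatic_chains G (Suc k) i j) (differential G r)"

definition dichromatic_boundaries ::
    "('v, 'e) multigraph \<Rightarrow> 'e rel \<Rightarrow> nat \<Rightarrow> nat \<Rightarrow> nat \<Rightarrow> (('v, 'e) state \<Rightarrow>\<^sub>0 int) set" where
  "dichromatic_boundaries G r k i j =
     (case k of 0 \<Rightarrow> {0}
      | Suc k' \<Rightarrow> differential G r ` carrier (dichromatic_chains G k' i j))"

definition dichromatic_homology ::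
    "('v, 'e) multigraph \<Rightarrow> 'e rel \<Rightarrow> nat \<Rightarrow> nat \<Rightarrow> nat \<Rightarrow> (('v, 'e) state \<Rightarrow>\<^sub>0 int) set monoid" where
  "dichromatic_homology G r k i j =
     ((dichromatic_chains G k i j)\<lparr>carrier := dichromatic_cycles G r k i j\<rparr>)
       Mod dichromatic_boundaries G r k i j"


section \<open>Rank and Euler characteristic\<close>

definition int_independent :: "('a, 'b) monoid_scheme \<Rightarrow> 'a set \<Rightarrow> bool" where
  "int_independent A B \<longleftrightarrow>
     (\<forall>c :: 'a \<Rightarrow> int. (\<Otimes>\<^bsub>A\<^esub>b\<in>B. b [^]\<^bsub>A\<^esub> c b) = \<one>\<^bsub>A\<^esub> \<longrightarrow> (\<forall>b\<in>B. c b = 0))"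

text \<open>The rank of a finitely generated abelian group: the largest size of a
  \<open>\<int>\<close>-linearly independent subset.\<close>

definition abelian_rank :: "('a, 'b) monoid_scheme \<Rightarrow> nat" where
  "abelian_rank A = Sup {card B | B. finite B \<and> B \<subseteq> carrier A \<and> int_independent A B}"

text \<open>A state has at most \<^term>\<open>card (edges G)\<close> edges, so the chain groups, and with them the
  homology groups, vanish for all larger \<open>k\<close>.\<close>

definition homology_euler_char :: "('v, 'e) multigraph \<Rightarrow> 'e rel \<Rightarrow> nat \<Rightarrow> nat \<Rightarrow> int" where
  "homology_euler_char G r i j =
     (\<Sum>k\<le>card (edges G). (- 1) ^ k * int (abelian_rank (dichromatic_homology G r k i j)))"

end

theory Submission
  imports Defs
begin

text \<open>
  Two facts are combined. The first is that the Euler characteristic of a finite complex of finitely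
  generated abelian groups equals that of its homology (\<open>euler_characteristic_homology\<close>), which
  rests on the additivity of the rank in short exact sequences (\<open>abelian_rank_additive\<close>). The
  number \<open>\<chi>(H\<^bsup>*,i,j\<^esup>(G))\<close> is therefore the alternating sum over \<open>k\<close> of the numbers of states with
  \<open>k\<close> edges, \<open>i\<close> labels \<open>y\<close> and \<open>j\<close> labels \<open>x\<close>.

  For this the differential must square to zero. A state is a triple \<open>(S, X, Y)\<close> of a set of edges, the
  set \<open>X\<close> of components labeled \<open>x\<close> and the set \<open>Y\<close> of edges labeled \<open>y\<close>. Adding edges sends each
  component to the one that contains it, and the result is nonzero exactly if this map is injective on
  \<open>X\<close>, whose image is then the new \<open>X\<close> (\<open>partial_differential_mk_state\<close>). In this form it is
  plain that partial differentials commute (\<open>push_push\<close>), and the signs make the terms of \<open>d\<^sup>2\<close> cancel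
  in pairs.

  The second fact is a count. Writing \<open>c(S)\<close> for the number of components of \<open>S\<close>, the weighted number of states,
  \<open>\<Sum>\<^sub>j (\<lambda> - 1)\<^sup>j \<chi>(H\<^bsup>*,i,j\<^esup>(G))\<close>, is \<open>\<Sum>\<^sub>S (-1)\<^bsup>|S|\<^esup> (|S| choose i) \<lambda>\<^bsup>c(S)\<^esup>\<close>
  (\<open>sum_states_eq_subset_expansion\<close>). At a positive integer \<open>n\<close> the power \<open>n\<^bsup>c(S)\<^esup>\<close>
  counts the colorings for which all edges of \<open>S\<close> are monochromatic. Exchanging the sums leaves, for each
  coloring, a sum over the subsets of its set of monochromatic edges, which is \<open>(-1)\<^sup>i\<close> if there are
  exactly \<open>i\<close> such edges and \<open>0\<close> otherwise (\<open>alternating_sum_Pow_choose\<close>).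
\<close>

section \<open>Independence and rank in abelian groups\<close>

text \<open>A homogeneous integer linear system with more unknowns \<^term>\<open>S\<close> than equations \<^term>\<open>T\<close> has
  a nontrivial integer solution, by fraction-free Gaussian elimination. This replaces the passage to
  vector spaces over the rationals.\<close>

lemma integer_system_nontrivial:
  fixes a :: "'s \<Rightarrow> 't \<Rightarrow> int"
  assumes "finite T" "finite S" "card T < card S"
  shows "\<exists>c. (\<exists>s\<in>S. c s \<noteq> 0) \<and> (\<forall>t\<in>T. (\<Sum>s\<in>S. c s * a s t) = 0)"
  using assms
proof (induction T arbitrary: S a rule: finite_induct)
  case empty
  then obtain s where "s \<in> S" by fastforce
  then show ?case by (intro exI[of _ "\<lambda>_. 1"]) auto
next
  case (insert t T)
  show ?case
  proof (cases "\<forall>s\<in>S. a s t = 0")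
    case True
    have "card T < card S" using insert by auto
    from insert.IH[OF insert.prems(1) this, of a] True show ?thesis by auto
  next
    case False
    then obtain p where p: "p \<in> S" "a p t \<noteq> 0" by blast
    define S' where "S' = S - {p}"
    have S': "finite S'" "S = insert p S'" "p \<notin> S'" and card: "card T < card S'"
      using p insert by (auto simp: S'_def)
    obtain c where c: "\<exists>s\<in>S'. c s \<noteq> 0"
      "\<And>t'. t' \<in> T \<Longrightarrow> (\<Sum>s\<in>S'. c s * (a p t * a s t' - a s t * a p t')) = 0"
      using insert.IH[OF S'(1) card, of "\<lambda>s t'. a p t * a s t' - a s t * a p t'"] by blast
    \<comment> \<open>The unknown \<open>p\<close> is eliminated by means of equation \<open>t\<close>; multiplying the other unknowns
        by the pivot \<open>a p t\<close> keeps the solution integral.\<close>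
    define d where "d s = (if s = p then - (\<Sum>s\<in>S'. c s * a s t) else a p t * c s)" for s
    have sum_d: "(\<Sum>s\<in>S. d s * a s t') = (\<Sum>s\<in>S'. c s * (a p t * a s t' - a s t * a p t'))" for t'
    proof -
      have "(\<Sum>s\<in>S. d s * a s t') = d p * a p t' + (\<Sum>s\<in>S'. d s * a s t')"
        using S' by simp
      also have "(\<Sum>s\<in>S'. d s * a s t') = (\<Sum>s\<in>S'. a p t * c s * a s t')"
        using S'(3) by (intro sum.cong) (auto simp: d_def)
      also have "d p = - (\<Sum>s\<in>S'. c s * a s t)" by (simp add: d_def)
      finally show ?thesis
        by (simp add: sum_distrib_right sum_distrib_left sum_subtractf algebra_simps)
    qed
    have "(\<Sum>s\<in>S. d s * a s t') = 0" if "t' \<in> insert t T" for t'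
      using that c(2) unfolding sum_d by (auto simp: mult.commute)
    moreover have "\<exists>s\<in>S. d s \<noteq> 0"
    proof -
      obtain s where "s \<in> S'" "c s \<noteq> 0" using c(1) by blast
      then show ?thesis using S' p by (intro bexI[of _ s]) (auto simp: d_def)
    qed
    ultimately show ?thesis by blast
  qed
qed

context comm_group
begin

lemma finprod_int_pow:
  fixes m :: int
  assumes "g \<in> I \<rightarrow> carrier G"
  shows "(\<Otimes>i\<in>I. g i) [^] m = (\<Otimes>i\<in>I. g i [^] m)"
  using assms
  by (induction I rule: infinite_finite_induct) (auto simp: int_pow_distrib Pi_iff)

lemma finprod_pow_sum:
  fixes c :: "'i \<Rightarrow> int"
  assumes "x \<in> carrier G"
  shows "(\<Otimes>i\<in>I. x [^] c i) = x [^] (\<Sum>i\<in>I. c i)"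
  by (induction I rule: infinite_finite_induct) (auto simp: assms int_pow_mult)

lemma finprod_swap:
  assumes "finite I" "finite J" "\<And>i j. i \<in> I \<Longrightarrow> j \<in> J \<Longrightarrow> f i j \<in> carrier G"
  shows "(\<Otimes>i\<in>I. \<Otimes>j\<in>J. f i j) = (\<Otimes>j\<in>J. \<Otimes>i\<in>I. f i j)"
  using assms(1,3)
proof (induction I rule: finite_induct)
  case (insert x I)
  have "(\<Otimes>j\<in>J. \<Otimes>i\<in>insert x I. f i j) = (\<Otimes>j\<in>J. f x j \<otimes> (\<Otimes>i\<in>I. f i j))"
    using insert by (intro finprod_cong') (auto intro!: m_closed finprod_closed)
  also have "\<dots> = (\<Otimes>j\<in>J. f x j) \<otimes> (\<Otimes>j\<in>J. \<Otimes>i\<in>I. f i j)"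
    using insert by (intro finprod_multf) (auto intro!: finprod_closed)
  finally show ?case using insert by (auto intro!: finprod_closed)
qed simp

lemma hom_finprod:
  assumes "comm_group H" "h \<in> hom G H" "g \<in> I \<rightarrow> carrier G"
  shows "h (\<Otimes>i\<in>I. g i) = (\<Otimes>\<^bsub>H\<^esub>i\<in>I. h (g i))"
proof -
  interpret H: comm_group H by fact
  interpret h: group_hom G H h by unfold_locales fact
  show ?thesis using assms(3)
    by (induction I rule: infinite_finite_induct) (auto simp: Pi_iff)
qed

end

text \<open>An element depends on \<^term>\<open>B\<close> if some nonzero multiple of it is an integer combination of
  \<^term>\<open>B\<close>, that is, if it lies in the rational span of \<^term>\<open>B\<close>.\<close>

definition depends_on :: "('a, 'b) monoid_scheme \<Rightarrow> 'a set \<Rightarrow> 'a \<Rightarrow> bool" where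
  "depends_on A B a \<longleftrightarrow>
     (\<exists>(m::int) (c :: 'a \<Rightarrow> int). m \<noteq> 0 \<and> a [^]\<^bsub>A\<^esub> m = (\<Otimes>\<^bsub>A\<^esub>b\<in>B. b [^]\<^bsub>A\<^esub> c b))"

text \<open>A finite set of independent elements on which all elements depend; it becomes a basis of
  \<open>A \<otimes> \<rat>\<close>. It need not generate \<^term>\<open>A\<close>.\<close>

definition rational_basis :: "('a, 'b) monoid_scheme \<Rightarrow> 'a set \<Rightarrow> bool" where
  "rational_basis A B \<longleftrightarrow> finite B \<and> B \<subseteq> carrier A \<and> int_independent A B
     \<and> (\<forall>a\<in>carrier A. depends_on A B a)"

context comm_group
begin

text \<open>The Steinitz bound: expressing multiples of the elements of \<^term>\<open>S\<close> through \<^term>\<open>T\<close> gives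
  an integer matrix, and a nontrivial solution of the associated linear system is a relation on
  \<^term>\<open>S\<close>.\<close>

lemma card_independent_le:
  assumes "finite S" "S \<subseteq> carrier G" "int_independent G S"
    and "finite T" "T \<subseteq> carrier G" "\<forall>s\<in>S. depends_on G T s"
  shows "card S \<le> card T"
proof (rule ccontr)
  assume "\<not> card S \<le> card T"
  then have less: "card T < card S" by simp
  from assms(6) obtain m a where m: "\<And>s. s \<in> S \<Longrightarrow> m s \<noteq> (0::int)"
    and a: "\<And>s. s \<in> S \<Longrightarrow> s [^] m s = (\<Otimes>t\<in>T. t [^] (a s t :: int))"
    unfolding depends_on_def by metis
  obtain c where c: "\<exists>s\<in>S. c s \<noteq> 0" "\<And>t. t \<in> T \<Longrightarrow> (\<Sum>s\<in>S. c s * a s t) = 0"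
    using integer_system_nontrivial[OF assms(4,1) less, of a] by blast
  have "(\<Otimes>s\<in>S. s [^] (m s * c s)) = (\<Otimes>s\<in>S. \<Otimes>t\<in>T. t [^] (c s * a s t))"
  proof (intro finprod_cong' refl)
    fix s assume s: "s \<in> S"
    have "s [^] (m s * c s) = (\<Otimes>t\<in>T. t [^] a s t) [^] c s"
      using s assms(2) by (simp add: a[symmetric] int_pow_pow subset_iff)
    also have "\<dots> = (\<Otimes>t\<in>T. (t [^] a s t) [^] c s)"
      using assms(5) by (intro finprod_int_pow) auto
    also have "\<dots> = (\<Otimes>t\<in>T. t [^] (c s * a s t))"
      using assms(5) by (intro finprod_cong') (auto simp: int_pow_pow mult.commute)
    finally show "s [^] (m s * c s) = (\<Otimes>t\<in>T. t [^] (c s * a s t))" .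
  qed (use assms(5) in \<open>auto intro!: finprod_closed\<close>)
  also have "\<dots> = (\<Otimes>t\<in>T. \<Otimes>s\<in>S. t [^] (c s * a s t))"
    using assms by (intro finprod_swap) auto
  also have "\<dots> = (\<Otimes>t\<in>T. \<one>)"
    using assms(5) c(2) by (intro finprod_cong') (auto simp: finprod_pow_sum)
  finally have "(\<Otimes>s\<in>S. s [^] (m s * c s)) = \<one>" by simp
  from assms(3)[unfolded int_independent_def, rule_format, of "\<lambda>s. m s * c s", OF this]
  show False using m c(1) by auto
qed

lemma abelian_rank_eq_card:
  assumes "rational_basis G B"
  shows "abelian_rank G = card B"
    and "finite S \<Longrightarrow> S \<subseteq> carrier G \<Longrightarrow> int_independent G S \<Longrightarrow> card S \<le> card B"
proof -
  show le: "card S \<le> card B" if "finite S" "S \<subseteq> carrier G" "int_independent G S" for S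
    using that assms unfolding rational_basis_def by (intro card_independent_le) auto
  show "abelian_rank G = card B"
    unfolding abelian_rank_def
    by (rule cSup_eq_maximum) (use assms le in \<open>auto simp: rational_basis_def\<close>)
qed

lemma depends_on_member:
  assumes "finite B" "B \<subseteq> carrier G" "b \<in> B"
  shows "depends_on G B b"
proof -
  have "(\<Otimes>x\<in>B. x [^] (if x = b then 1 else 0::int)) = (\<Otimes>x\<in>B. if b = x then x else \<one>)"
    using assms by (intro finprod_cong') auto
  also have "\<dots> = b" using assms by (intro finprod_singleton) auto
  finally show ?thesis unfolding depends_on_def
    using assms by (intro exI[of _ 1] exI[of _ "\<lambda>x. if x = b then 1 else 0"]) auto
qed

text \<open>If the size of independent sets is bounded, then an independent set of maximal size is a rational
  basis.\<close>

lemma rational_basis_exists: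
  assumes "\<And>S. finite S \<Longrightarrow> S \<subseteq> carrier G \<Longrightarrow> int_independent G S \<Longrightarrow> card S \<le> N"
  shows "\<exists>B. rational_basis G B"
proof -
  define P where "P S \<longleftrightarrow> finite S \<and> S \<subseteq> carrier G \<and> int_independent G S" for S
  have "P {}" by (simp add: P_def int_independent_def)
  moreover have "\<forall>S. P S \<longrightarrow> card S < Suc N" using assms by (auto simp: P_def less_Suc_eq_le)
  ultimately obtain B where B: "P B" "\<And>S. P S \<Longrightarrow> card S \<le> card B"
    using ex_has_greatest_nat[of P "{}" card "Suc N"] by auto
  have fin: "finite B" and sub: "B \<subseteq> carrier G" and ind: "int_independent G B"
    using B(1) by (auto simp: P_def)
  have "depends_on G B a" if a: "a \<in> carrier G" for a
  proof (cases "a \<in> B")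
    case True
    then show ?thesis using fin sub by (intro depends_on_member)
  next
    case False
    have "\<not> P (insert a B)" using B(2)[of "insert a B"] False fin by auto
    then have "\<not> int_independent G (insert a B)" using fin sub a by (auto simp: P_def)
    then obtain c where c: "(\<Otimes>b\<in>insert a B. b [^] c b) = \<one>" "\<exists>b\<in>insert a B. c b \<noteq> (0::int)"
      unfolding int_independent_def by blast
    have eq: "a [^] c a \<otimes> (\<Otimes>b\<in>B. b [^] c b) = \<one>"
      using c(1) False fin sub a by (subst (asm) finprod_insert) auto
    have "c a \<noteq> 0"
    proof
      assume 0: "c a = 0"
      with eq have "(\<Otimes>b\<in>B. b [^] c b) = \<one>" using sub by (simp add: Pi_iff subset_iff)
      with ind c(2) 0 show False unfolding int_independent_def by blast
    qed
    have cl: "(\<Otimes>b\<in>B. b [^] c b) \<in> carrier G" using sub by (auto intro!: finprod_closed)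
    have "a [^] (- c a) = inv (a [^] c a)" using a by (simp add: int_pow_neg)
    also have "\<dots> = (\<Otimes>b\<in>B. b [^] c b)" using eq cl a
      by (metis int_pow_closed inv_equality inv_inv inv_closed)
    finally show ?thesis unfolding depends_on_def using \<open>c a \<noteq> 0\<close>
      by (intro exI[of _ "- c a"] exI[of _ c]) auto
  qed
  then show ?thesis using fin sub ind by (auto simp: rational_basis_def)
qed

lemma one_not_in_independent:
  assumes "int_independent G B"  "finite B"
  shows "\<one> \<notin> B"
proof
  assume "\<one> \<in> B"
  have "(\<Otimes>b\<in>B. b [^] (if b = \<one> then 1 else 0::int)) = \<one>"
    by (intro finprod_one_eqI) auto
  with assms(1)[unfolded int_independent_def, THEN spec, of "\<lambda>b. if b = \<one> then 1 else 0"]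
  have "\<forall>b\<in>B. (if b = \<one> then 1 else 0::int) = 0" by blast
  with \<open>\<one> \<in> B\<close> show False by auto
qed

end

section \<open>Additivity of the rank\<close>

text \<open>A short exact sequence \<open>1 \<rightarrow> K \<rightarrow> G \<rightarrow> H \<rightarrow> 1\<close> of abelian groups. Subgroups and quotients are
  both treated through the maps of such a sequence.\<close>

locale short_exact =
  K: comm_group K + G: comm_group G + H: comm_group H
  for K (structure) and G (structure) and H (structure) +
  fixes f g
  assumes f_hom: "f \<in> hom K G" and g_hom: "g \<in> hom G H"
    and f_inj: "inj_on f (carrier K)"
    and g_surj: "g ` carrier G = carrier H"
    and exact: "f ` carrier K = {a \<in> carrier G. g a = \<one>\<^bsub>H\<^esub>}"
begin

sublocale f: group_hom K G f using f_hom by unfold_locales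
sublocale g: group_hom G H g using g_hom by unfold_locales

lemma g_f [simp]: "k \<in> carrier K \<Longrightarrow> g (f k) = \<one>\<^bsub>H\<^esub>"
  using exact by auto

text \<open>The image of an independent set of \<^term>\<open>K\<close> together with a lift of an independent set of
  \<^term>\<open>H\<close> is independent in \<^term>\<open>G\<close>, and it is a rational basis if both sets are.\<close>

lemma union_lift:
  assumes "finite B" "B \<subseteq> carrier K" "int_independent K B"
    and "finite C" "C \<subseteq> carrier H" "int_independent H C"
  obtains D where "finite D" "D \<subseteq> carrier G" "int_independent G D" "card D = card B + card C"
    "(\<forall>k\<in>carrier K. depends_on K B k) \<Longrightarrow> (\<forall>x\<in>carrier H. depends_on H C x) \<Longrightarrow>
       (\<forall>a\<in>carrier G. depends_on G D a)"
proof -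
  have "\<forall>x\<in>C. \<exists>a\<in>carrier G. g a = x" using assms(5) g_surj by (metis image_iff subsetD)
  then obtain l where l: "\<And>x. x \<in> C \<Longrightarrow> l x \<in> carrier G" "\<And>x. x \<in> C \<Longrightarrow> g (l x) = x"
    by metis
  have inj_l: "inj_on l C" using l(2) by (metis inj_onI)
  have inj_f: "inj_on f B" using f_inj assms(2) by (rule inj_on_subset)
  have disj: "f ` B \<inter> l ` C = {}"
  proof -
    have "\<one>\<^bsub>H\<^esub> \<notin> C" using H.one_not_in_independent assms by blast
    then show ?thesis using l(2) assms(2) by auto (metis g_f subsetD)
  qed
  define D where "D = f ` B \<union> l ` C"
  have sub: "f ` B \<subseteq> carrier G" "l ` C \<subseteq> carrier G" "D \<subseteq> carrier G"
    using assms(2) l(1) by (auto simp: D_def)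
  have split: "(\<Otimes>\<^bsub>G\<^esub>d\<in>D. d [^]\<^bsub>G\<^esub> (c d::int)) =
      f (\<Otimes>\<^bsub>K\<^esub>b\<in>B. b [^]\<^bsub>K\<^esub> c (f b)) \<otimes>\<^bsub>G\<^esub> (\<Otimes>\<^bsub>G\<^esub>x\<in>C. l x [^]\<^bsub>G\<^esub> c (l x))" for c
  proof -
    have "(\<Otimes>\<^bsub>G\<^esub>d\<in>D. d [^]\<^bsub>G\<^esub> c d) =
        (\<Otimes>\<^bsub>G\<^esub>d\<in>f ` B. d [^]\<^bsub>G\<^esub> c d) \<otimes>\<^bsub>G\<^esub> (\<Otimes>\<^bsub>G\<^esub>d\<in>l ` C. d [^]\<^bsub>G\<^esub> c d)"
      unfolding D_def using assms disj sub by (intro G.finprod_Un_disjoint) auto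
    also have "(\<Otimes>\<^bsub>G\<^esub>d\<in>l ` C. d [^]\<^bsub>G\<^esub> c d) = (\<Otimes>\<^bsub>G\<^esub>x\<in>C. l x [^]\<^bsub>G\<^esub> c (l x))"
      using sub inj_l by (intro G.finprod_reindex) auto
    also have "(\<Otimes>\<^bsub>G\<^esub>d\<in>f ` B. d [^]\<^bsub>G\<^esub> c d) = (\<Otimes>\<^bsub>G\<^esub>b\<in>B. f b [^]\<^bsub>G\<^esub> c (f b))"
      using sub inj_f by (intro G.finprod_reindex) auto
    also have "\<dots> = (\<Otimes>\<^bsub>G\<^esub>b\<in>B. f (b [^]\<^bsub>K\<^esub> c (f b)))"
      using assms(2) by (intro G.finprod_cong') (auto simp: f.hom_int_pow)
    also have "\<dots> = f (\<Otimes>\<^bsub>K\<^esub>b\<in>B. b [^]\<^bsub>K\<^esub> c (f b))"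
      using assms(2) by (intro K.hom_finprod[symmetric] f_hom G.comm_group_axioms) auto
    finally show ?thesis .
  qed
  have clK: "(\<Otimes>\<^bsub>K\<^esub>b\<in>B. b [^]\<^bsub>K\<^esub> (c b::int)) \<in> carrier K" for c
    using assms(2) by (auto intro!: K.finprod_closed)
  have clC: "(\<Otimes>\<^bsub>G\<^esub>x\<in>C. l x [^]\<^bsub>G\<^esub> (c x::int)) \<in> carrier G" for c
    using l(1) by (auto intro!: G.finprod_closed)
  have g_lift: "g (\<Otimes>\<^bsub>G\<^esub>x\<in>C. l x [^]\<^bsub>G\<^esub> (c x::int)) = (\<Otimes>\<^bsub>H\<^esub>x\<in>C. x [^]\<^bsub>H\<^esub> c x)" for c
  proof -
    have "g (\<Otimes>\<^bsub>G\<^esub>x\<in>C. l x [^]\<^bsub>G\<^esub> c x) = (\<Otimes>\<^bsub>H\<^esub>x\<in>C. g (l x [^]\<^bsub>G\<^esub> c x))"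
      using l(1) by (intro G.hom_finprod g_hom H.comm_group_axioms) auto
    also have "\<dots> = (\<Otimes>\<^bsub>H\<^esub>x\<in>C. x [^]\<^bsub>H\<^esub> c x)"
      using l assms(5) by (intro H.finprod_cong') (auto simp: g.hom_int_pow)
    finally show ?thesis .
  qed
  have ind: "int_independent G D"
    unfolding int_independent_def
  proof (intro allI impI)
    fix c :: "_ \<Rightarrow> int"
    assume 1: "(\<Otimes>\<^bsub>G\<^esub>d\<in>D. d [^]\<^bsub>G\<^esub> c d) = \<one>\<^bsub>G\<^esub>"
    have "g (\<Otimes>\<^bsub>G\<^esub>d\<in>D. d [^]\<^bsub>G\<^esub> c d) = (\<Otimes>\<^bsub>H\<^esub>x\<in>C. x [^]\<^bsub>H\<^esub> c (l x))"
    proof -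
      have "(\<Otimes>\<^bsub>H\<^esub>x\<in>C. x [^]\<^bsub>H\<^esub> c (l x)) \<in> carrier H"
        using assms(5) by (auto intro!: H.finprod_closed)
      then show ?thesis unfolding split using clK clC by (simp add: g_lift)
    qed
    then have "(\<Otimes>\<^bsub>H\<^esub>x\<in>C. x [^]\<^bsub>H\<^esub> c (l x)) = \<one>\<^bsub>H\<^esub>" unfolding 1 by simp
    then have C0: "\<forall>x\<in>C. c (l x) = 0"
      using assms(6)[unfolded int_independent_def, rule_format, of "\<lambda>x. c (l x)"] by blast
    then have "(\<Otimes>\<^bsub>G\<^esub>x\<in>C. l x [^]\<^bsub>G\<^esub> c (l x)) = \<one>\<^bsub>G\<^esub>"
      by (intro G.finprod_one_eqI) auto
    then have "f (\<Otimes>\<^bsub>K\<^esub>b\<in>B. b [^]\<^bsub>K\<^esub> c (f b)) = \<one>\<^bsub>G\<^esub>"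
      using 1 clK unfolding split by simp
    then have "(\<Otimes>\<^bsub>K\<^esub>b\<in>B. b [^]\<^bsub>K\<^esub> c (f b)) = \<one>\<^bsub>K\<^esub>"
      by (intro inj_onD[OF f_inj]) (simp_all only: f.hom_one clK[of "\<lambda>b. c (f b)"] K.one_closed)
    then have "\<forall>b\<in>B. c (f b) = 0"
      using assms(3)[unfolded int_independent_def, rule_format, of "\<lambda>x. c (f x)"] by blast
    with C0 show "\<forall>d\<in>D. c d = 0" by (auto simp: D_def)
  qed
  have card: "card D = card B + card C"
    unfolding D_def using assms disj inj_f inj_l by (simp add: card_Un_disjoint card_image)
  have dep: "depends_on G D a"
    if K: "\<forall>k\<in>carrier K. depends_on K B k" and H: "\<forall>x\<in>carrier H. depends_on H C x"
      and a: "a \<in> carrier G" for a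
  proof -
    obtain m c where m: "m \<noteq> (0::int)" and c: "g a [^]\<^bsub>H\<^esub> m = (\<Otimes>\<^bsub>H\<^esub>x\<in>C. x [^]\<^bsub>H\<^esub> (c x::int))"
      using H g.hom_closed[OF a] unfolding depends_on_def by blast
    define y where "y = (\<Otimes>\<^bsub>G\<^esub>x\<in>C. l x [^]\<^bsub>G\<^esub> c x)"
    have y: "y \<in> carrier G" "g y = g (a [^]\<^bsub>G\<^esub> m)"
      using clC a by (auto simp: y_def g_lift c g.hom_int_pow)
    then have "a [^]\<^bsub>G\<^esub> m \<otimes>\<^bsub>G\<^esub> inv\<^bsub>G\<^esub> y \<in> f ` carrier K"
      unfolding exact using a by simp
    then obtain k where k: "k \<in> carrier K" "f k = a [^]\<^bsub>G\<^esub> m \<otimes>\<^bsub>G\<^esub> inv\<^bsub>G\<^esub> y" by auto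
    obtain n e where n: "n \<noteq> (0::int)" and e: "k [^]\<^bsub>K\<^esub> n = (\<Otimes>\<^bsub>K\<^esub>b\<in>B. b [^]\<^bsub>K\<^esub> (e b::int))"
      using K k unfolding depends_on_def by blast
    define u where "u d = (if d \<in> f ` B then e (inv_into B f d) else n * c (g d))" for d
    have "(\<Otimes>\<^bsub>G\<^esub>d\<in>D. d [^]\<^bsub>G\<^esub> u d) =
        f (\<Otimes>\<^bsub>K\<^esub>b\<in>B. b [^]\<^bsub>K\<^esub> e b) \<otimes>\<^bsub>G\<^esub> (\<Otimes>\<^bsub>G\<^esub>x\<in>C. (l x [^]\<^bsub>G\<^esub> c x) [^]\<^bsub>G\<^esub> n)"
    proof -
      have "(\<Otimes>\<^bsub>K\<^esub>b\<in>B. b [^]\<^bsub>K\<^esub> u (f b)) = (\<Otimes>\<^bsub>K\<^esub>b\<in>B. b [^]\<^bsub>K\<^esub> e b)"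
        using assms(2) inj_f by (intro K.finprod_cong') (auto simp: u_def)
      moreover have "(\<Otimes>\<^bsub>G\<^esub>x\<in>C. l x [^]\<^bsub>G\<^esub> u (l x)) = (\<Otimes>\<^bsub>G\<^esub>x\<in>C. (l x [^]\<^bsub>G\<^esub> c x) [^]\<^bsub>G\<^esub> n)"
        using l disj by (intro G.finprod_cong') (auto simp: u_def G.int_pow_pow mult.commute)
      ultimately show ?thesis unfolding split by simp
    qed
    also have "(\<Otimes>\<^bsub>G\<^esub>x\<in>C. (l x [^]\<^bsub>G\<^esub> c x) [^]\<^bsub>G\<^esub> n) = y [^]\<^bsub>G\<^esub> n"
      unfolding y_def using l(1) by (intro G.finprod_int_pow[symmetric]) auto
    also have "f (\<Otimes>\<^bsub>K\<^esub>b\<in>B. b [^]\<^bsub>K\<^esub> e b) = f k [^]\<^bsub>G\<^esub> n"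
      using k(1) by (simp add: e[symmetric] f.hom_int_pow)
    also have "f k [^]\<^bsub>G\<^esub> n \<otimes>\<^bsub>G\<^esub> y [^]\<^bsub>G\<^esub> n = (f k \<otimes>\<^bsub>G\<^esub> y) [^]\<^bsub>G\<^esub> n"
      using k(1) y(1) by (simp add: G.int_pow_distrib)
    also have "f k \<otimes>\<^bsub>G\<^esub> y = a [^]\<^bsub>G\<^esub> m"
      unfolding k(2) using a y(1) by (simp add: G.m_assoc)
    also have "(a [^]\<^bsub>G\<^esub> m) [^]\<^bsub>G\<^esub> n = a [^]\<^bsub>G\<^esub> (m * n)"
      using a by (simp add: G.int_pow_pow)
    finally show ?thesis unfolding depends_on_def using m n
      by (intro exI[of _ "m * n"] exI[of _ u]) auto
  qed
  show ?thesis
    by (rule that[of D]) (use assms sub ind card dep in \<open>auto simp: D_def\<close>)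
qed

theorem abelian_rank_additive:
  assumes "rational_basis G A"
  shows "abelian_rank G = abelian_rank K + abelian_rank H"
    and "\<exists>B. rational_basis K B" and "\<exists>C. rational_basis H C"
proof -
  have "card S \<le> card A" if S: "finite S" "S \<subseteq> carrier K" "int_independent K S" for S
  proof -
    obtain D where "finite D" "D \<subseteq> carrier G" "int_independent G D" "card D = card S"
      by (rule union_lift[OF S, of "{}"]) (auto simp: int_independent_def)
    then show ?thesis using G.abelian_rank_eq_card(2)[OF assms, of D] by simp
  qed
  then show "\<exists>B. rational_basis K B" by (rule K.rational_basis_exists)
  then obtain B where B: "rational_basis K B" ..
  have "card S \<le> card A" if S: "finite S" "S \<subseteq> carrier H" "int_independent H S" for S
  proof -
    obtain D where "finite D" "D \<subseteq> carrier G" "int_independent G D" "card D = card S"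
      by (rule union_lift[of "{}", OF _ _ _ S]) (auto simp: int_independent_def)
    then show ?thesis using G.abelian_rank_eq_card(2)[OF assms, of D] by simp
  qed
  then show "\<exists>C. rational_basis H C" by (rule H.rational_basis_exists)
  then obtain C where C: "rational_basis H C" ..
  obtain D where "rational_basis G D" "card D = card B + card C"
    using union_lift[of B C] B C unfolding rational_basis_def by metis
  then show "abelian_rank G = abelian_rank K + abelian_rank H"
    using G.abelian_rank_eq_card(1) K.abelian_rank_eq_card(1)[OF B]
      H.abelian_rank_eq_card(1)[OF C] by simp
qed

end

text \<open>Consequently the rank of a free abelian group of finite rank is the number of its generators.\<close>

lemma rational_basis_free_Abelian_group:
  assumes "finite S"
  shows "rational_basis (free_Abelian_group S) (frag_of ` S)"
proof -
  let ?F = "free_Abelian_group S"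
  interpret F: comm_group ?F by (rule abelian_free_Abelian_group)
  have prod: "(\<Otimes>\<^bsub>?F\<^esub>b\<in>frag_of ` S. b [^]\<^bsub>?F\<^esub> (c b :: int)) = (\<Sum>s\<in>S. frag_cmul (c (frag_of s)) (frag_of s))"
    for c
  proof -
    have "(\<Otimes>\<^bsub>?F\<^esub>b\<in>frag_of ` S. b [^]\<^bsub>?F\<^esub> c b) = (\<Otimes>\<^bsub>?F\<^esub>s\<in>S. frag_of s [^]\<^bsub>?F\<^esub> c (frag_of s))"
      by (intro F.finprod_reindex) (auto simp: inj_on_def frag_of_eq)
    moreover have "T \<subseteq> S \<Longrightarrow> (\<Otimes>\<^bsub>?F\<^esub>s\<in>T. frag_of s [^]\<^bsub>?F\<^esub> c (frag_of s)) =
        (\<Sum>s\<in>T. frag_cmul (c (frag_of s)) (frag_of s))" for T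
    proof (induction T rule: infinite_finite_induct)
      case (insert x T)
      have "frag_of s [^]\<^bsub>?F\<^esub> c (frag_of s) \<in> carrier ?F" if "s \<in> insert x T" for s
        by (rule F.int_pow_closed) (use that insert.prems in auto)
      then show ?case using insert by (subst F.finprod_insert) (auto intro!: Pi_I)
    qed auto
    ultimately show ?thesis by simp
  qed
  have "int_independent ?F (frag_of ` S)"
    unfolding int_independent_def prod
  proof (intro allI impI)
    fix c :: "('a \<Rightarrow>\<^sub>0 int) \<Rightarrow> int"
    assume "(\<Sum>s\<in>S. frag_cmul (c (frag_of s)) (frag_of s)) = \<one>\<^bsub>?F\<^esub>"
    then have 0: "Poly_Mapping.lookup (\<Sum>s\<in>S. frag_cmul (c (frag_of s)) (frag_of s)) t = 0" for t
      by simp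
    have "c (frag_of t) = 0" if "t \<in> S" for t
      using 0[of t] that assms by (simp add: lookup_sum  if_distrib[of "\<lambda>x. _ * x"] lookup_frag_of cong: if_cong)
    then show "\<forall>b\<in>frag_of ` S. c b = 0" by auto
  qed
  moreover have "depends_on ?F (frag_of ` S) a" if a: "a \<in> carrier ?F" for a
  proof -
    have "a = (\<Sum>s\<in>Poly_Mapping.keys a. frag_cmul (Poly_Mapping.lookup a s) (frag_of s))"
      using frag_expansion[of a] by (simp add: frag_extend_def)
    also have "\<dots> = (\<Sum>s\<in>S. frag_cmul (Poly_Mapping.lookup a s) (frag_of s))"
      using a assms by (intro sum.mono_neutral_left) (auto simp: in_keys_iff)
    also have "\<dots> = (\<Otimes>\<^bsub>?F\<^esub>b\<in>frag_of ` S. b [^]\<^bsub>?F\<^esub> Poly_Mapping.lookup a (inv_into S frag_of b))"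
      unfolding prod by (intro sum.cong refl, subst inv_into_f_f) (auto simp: inj_on_def frag_of_eq)
    finally show ?thesis unfolding depends_on_def using a
      by (intro exI[of _ 1] exI) (auto simp: F.int_pow_1 simp del: int_pow_free_Abelian_group)
  qed
  ultimately show ?thesis using assms by (auto simp: rational_basis_def)
qed

section \<open>The Euler characteristic of a complex of abelian groups\<close>

lemma (in comm_group) subgroup_comm_group:
  assumes "subgroup K G"
  shows "comm_group (G\<lparr>carrier := K\<rparr>)"
proof -
  have "group (G\<lparr>carrier := K\<rparr>)" using subgroup.subgroup_is_group[OF assms] by simp
  then show ?thesis
    by (rule group.group_comm_groupI) (use subgroup.subset[OF assms] in \<open>auto intro: m_comm\<close>)
qed

lemma subgroup_quotient_short_exact:
  assumes "comm_group Z" "subgroup B Z"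
  shows "short_exact (Z\<lparr>carrier := B\<rparr>) Z (Z Mod B) id (\<lambda>z. B #>\<^bsub>Z\<^esub> z)"
proof -
  interpret Z: comm_group Z by fact
  interpret B: normal B Z using Z.subgroup_imp_normal[OF assms(2)] .
  interpret Q: comm_group "Z Mod B" by (rule Z.abelian_FactGroup[OF assms(2)])
  interpret K: comm_group "Z\<lparr>carrier := B\<rparr>" by (rule Z.subgroup_comm_group[OF assms(2)])
  show ?thesis
  proof
    show "id \<in> hom (Z\<lparr>carrier := B\<rparr>) Z" using B.subset by (auto simp: hom_def)
    show "(\<lambda>z. B #>\<^bsub>Z\<^esub> z) \<in> hom Z (Z Mod B)" by (rule B.r_coset_hom_Mod)
    show "(\<lambda>z. B #>\<^bsub>Z\<^esub> z) ` carrier Z = carrier (Z Mod B)" by (simp add: carrier_FactGroup)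
    show "id ` carrier (Z\<lparr>carrier := B\<rparr>) = {a \<in> carrier Z. B #>\<^bsub>Z\<^esub> a = \<one>\<^bsub>Z Mod B\<^esub>}"
      using B.subset Z.coset_join1[OF _ _ assms(2)] Z.coset_join2[OF _ assms(2)] by auto
  qed auto
qed

lemma kernel_image_short_exact:
  assumes "comm_group C" "comm_group D" "h \<in> hom C D"
  shows "short_exact (C\<lparr>carrier := kernel C D h\<rparr>) C (D\<lparr>carrier := h ` carrier C\<rparr>) id h"
proof -
  interpret C: comm_group C by fact
  interpret D: comm_group D by fact
  interpret h: group_hom C D h by unfold_locales fact
  interpret K: comm_group "C\<lparr>carrier := kernel C D h\<rparr>"
    by (rule C.subgroup_comm_group[OF h.subgroup_kernel])
  interpret I: comm_group "D\<lparr>carrier := h ` carrier C\<rparr>"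
    by (rule D.subgroup_comm_group[OF h.img_is_subgroup])
  show ?thesis
    by unfold_locales (auto simp: hom_def kernel_def)
qed

lemma abelian_rank_trivial:
  assumes "comm_group A" "carrier A = {\<one>\<^bsub>A\<^esub>}"
  shows "abelian_rank A = 0"
proof -
  interpret A: comm_group A by fact
  have "rational_basis A {}"
    using assms(2) by (auto simp: rational_basis_def int_independent_def depends_on_def intro: exI[of _ 1])
  then show ?thesis using A.abelian_rank_eq_card(1) by force
qed

text \<open>The Euler characteristic of a complex that vanishes above degree \<^term>\<open>m\<close> equals that of its
  homology. With \<open>b\<^sub>k\<close> the rank of the boundaries in degree \<open>k\<close>, additivity gives
  \<open>rank C\<^sub>k = rank H\<^sub>k + b\<^sub>k + b\<^sub>k\<^sub>+\<^sub>1\<close>, and the alternating sum telescopes.\<close>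

theorem euler_characteristic_homology:
  fixes C :: "nat \<Rightarrow> ('a, 'm) monoid_scheme" and d :: "'a \<Rightarrow> 'a"
  defines "Z \<equiv> \<lambda>k. kernel (C k) (C (Suc k)) d"
  defines "B \<equiv> \<lambda>k. case k of 0 \<Rightarrow> {\<one>\<^bsub>C 0\<^esub>} | Suc k' \<Rightarrow> d ` carrier (C k')"
  assumes comm: "\<And>k. comm_group (C k)"
    and basis: "\<And>k. \<exists>A. rational_basis (C k) A"
    and hom: "\<And>k. d \<in> hom (C k) (C (Suc k))"
    and dd: "\<And>k x. x \<in> carrier (C k) \<Longrightarrow> d (d x) = \<one>\<^bsub>C (Suc (Suc k))\<^esub>"
    and top: "carrier (C (Suc m)) = {\<one>\<^bsub>C (Suc m)\<^esub>}"
  shows "(\<Sum>k\<le>m. (- 1) ^ k * int (abelian_rank ((C k)\<lparr>carrier := Z k\<rparr> Mod B k))) =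
         (\<Sum>k\<le>m. (- 1) ^ k * int (abelian_rank (C k)))"
proof -
  define b where "b k = abelian_rank ((C k)\<lparr>carrier := B k\<rparr>)" for k
  have hom': "group_hom (C k) (C (Suc k)) d" for k
    using comm[of k] comm[of "Suc k"] hom[of k]
    by (simp add: group_hom_def group_hom_axioms_def comm_group_def)
  have subB: "subgroup (B k) (C k)" for k
  proof (cases k)
    case 0
    then show ?thesis using comm[of 0] group.triv_subgroup[of "C 0"] by (simp add: B_def comm_group_def)
  next
    case (Suc k')
    then show ?thesis using group_hom.img_is_subgroup[OF hom'[of k']] by (simp add: B_def)
  qed
  have subZ: "subgroup (Z k) (C k)" for k
    unfolding Z_def by (rule group_hom.subgroup_kernel[OF hom'])
  have BZ: "B k \<subseteq> Z k" for k
  proof (cases k)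
    case 0
    then show ?thesis using subgroup.one_closed[OF subZ[of 0]] by (simp add: B_def)
  next
    case (Suc k')
    then show ?thesis using dd[of _ k'] subgroup.subset[OF subB[of k]] by (auto simp: B_def Z_def kernel_def)
  qed
  have step: "abelian_rank (C k) = abelian_rank ((C k)\<lparr>carrier := Z k\<rparr> Mod B k) + b k + b (Suc k)" for k
  proof -
    obtain A where A: "rational_basis (C k) A" using basis by blast
    have Zc: "comm_group ((C k)\<lparr>carrier := Z k\<rparr>)"
      by (rule comm_group.subgroup_comm_group[OF comm subZ])
    have "subgroup (B k) ((C k)\<lparr>carrier := Z k\<rparr>)"
      using group.subgroup_incl[OF _ subB subZ BZ] comm[of k] by (simp add: comm_group_def)
    from subgroup_quotient_short_exact[OF Zc this]
    interpret E1: short_exact "(C k)\<lparr>carrier := B k\<rparr>" "(C k)\<lparr>carrier := Z k\<rparr>"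
      "(C k)\<lparr>carrier := Z k\<rparr> Mod B k" id "\<lambda>z. B k #>\<^bsub>(C k)\<lparr>carrier := Z k\<rparr>\<^esub> z"
      by simp
    have "B (Suc k) = d ` carrier (C k)" by (simp add: B_def)
    with kernel_image_short_exact[OF comm comm hom, of k]
    interpret E2: short_exact "(C k)\<lparr>carrier := Z k\<rparr>" "C k" "(C (Suc k))\<lparr>carrier := B (Suc k)\<rparr>" id d
      by (simp add: Z_def)
    obtain A' where "rational_basis ((C k)\<lparr>carrier := Z k\<rparr>) A'"
      using E2.abelian_rank_additive(2)[OF A] by blast
    from E1.abelian_rank_additive(1)[OF this] E2.abelian_rank_additive(1)[OF A]
    show ?thesis by (simp add: b_def)
  qed
  have "(\<Sum>k\<le>n. (- 1) ^ k * int (abelian_rank (C k))) =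
        (\<Sum>k\<le>n. (- 1) ^ k * int (abelian_rank ((C k)\<lparr>carrier := Z k\<rparr> Mod B k)))
          + int (b 0) + (- 1) ^ n * int (b (Suc n))" for n
  proof (induction n)
    case 0
    then show ?case by (simp add: step)
  next
    case (Suc n)
    then show ?case by (simp add: step[of "Suc n"] algebra_simps)
  qed
  moreover have "b k = 0" if "B k = {\<one>\<^bsub>C k\<^esub>}" for k
    unfolding b_def
    by (rule abelian_rank_trivial[OF comm_group.subgroup_comm_group[OF comm subB]]) (simp add: that)
  moreover have "B (Suc m) = {\<one>\<^bsub>C (Suc m)\<^esub>}"
    using subgroup.subset[OF subB[of "Suc m"]] subgroup.one_closed[OF subB[of "Suc m"]] top by auto
  moreover have "B 0 = {\<one>\<^bsub>C 0\<^esub>}" by (simp add: B_def)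
  ultimately show ?thesis by simp
qed

section \<open>Merging components\<close>

text \<open>For a component \<^term>\<open>A\<close> of a subgraph of \<^term>\<open>T\<close>, this is the component of \<^term>\<open>T\<close> that
  contains \<^term>\<open>A\<close>. On components, merging is functorial in inclusions of subgraphs.\<close>

definition merge :: "('v, 'e) multigraph \<Rightarrow> 'e set \<Rightarrow> 'v set \<Rightarrow> 'v set" where
  "merge G T A = (\<Union>u\<in>A. component_of G T u)"

text \<open>The state on the subgraph \<^term>\<open>S\<close> in which the components in \<^term>\<open>X\<close> are labeled \<open>x\<close>, the
  edges in \<^term>\<open>Y\<close> are labeled \<open>y\<close>, and everything else is labeled \<open>1\<close>. It is meant for
  \<^term>\<open>X\<close> a set of components and \<^term>\<open>Y\<close> a set of edges of \<^term>\<open>S\<close>.\<close>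

definition mk_state :: "('v, 'e) multigraph \<Rightarrow> 'e set \<Rightarrow> 'v set set \<Rightarrow> 'e set \<Rightarrow> ('v, 'e) state" where
  "mk_state G S X Y =
     \<lparr>sedges = S,
      clabel = (\<lambda>A. if A \<in> components_of G S then Some (if A \<in> X then CompX else CompOne) else None),
      elabel = (\<lambda>e. if e \<in> S then Some (if e \<in> Y then EdgeY else EdgeOne) else None)\<rparr>"

locale fin_graph =
  fixes G :: "('v, 'e) multigraph"
  assumes fin: "finite_multigraph G"
begin

abbreviation "V \<equiv> nodes G"
abbreviation "E \<equiv> edges G"
abbreviation "cmp \<equiv> component_of G"
abbreviation "cmps \<equiv> components_of G"

lemma finite_V: "finite V" and finite_E: "finite E"
  using fin by (auto simp: finite_multigraph_def)

lemma finite_comps: "finite (cmps S)"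
  by (simp add: components_of_def finite_V)

lemma card_comps_le: "card (cmps S) \<le> card V"
  unfolding components_of_def by (rule card_image_le[OF finite_V])

lemma sym_adjacency: "sym (adjacency G S)"
  by (auto simp: adjacency_def sym_def) (metis Upair_inject)

lemma reach_sym: "(u, v) \<in> (adjacency G S)\<^sup>* \<Longrightarrow> (v, u) \<in> (adjacency G S)\<^sup>*"
  using sym_rtrancl[OF sym_adjacency] by (rule symD)

lemma comp_self: "u \<in> V \<Longrightarrow> u \<in> cmp S u"
  by (simp add: component_of_def)

lemma comp_eq_iff:
  assumes "u \<in> V" "v \<in> V"
  shows "cmp S u = cmp S v \<longleftrightarrow> (u, v) \<in> (adjacency G S)\<^sup>*"
proof
  assume "cmp S u = cmp S v"
  then have "v \<in> cmp S u" using comp_self[OF assms(2)] by simp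
  then show "(u, v) \<in> (adjacency G S)\<^sup>*" by (simp add: component_of_def)
next
  assume "(u, v) \<in> (adjacency G S)\<^sup>*"
  then show "cmp S u = cmp S v"
    using reach_sym by (auto simp: component_of_def intro: rtrancl_trans)
qed

lemma comp_mem: "v \<in> cmp S u \<Longrightarrow> u \<in> V \<Longrightarrow> cmp S v = cmp S u"
  using comp_eq_iff[of u v S] by (auto simp: component_of_def)

lemma comp_mono: "S \<subseteq> T \<Longrightarrow> cmp S u \<subseteq> cmp T u"
  using rtrancl_mono[of "adjacency G S" "adjacency G T"]
  by (fastforce simp: component_of_def adjacency_def)

lemma merge_comp:
  assumes "S \<subseteq> T" "u \<in> V"
  shows "merge G T (cmp S u) = cmp T u"
  using comp_mem[of _ T u] comp_mono[OF assms(1), of u] comp_self[OF assms(2)] assms(2)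
  unfolding merge_def by blast

lemma merge_in_comps: "S \<subseteq> T \<Longrightarrow> A \<in> cmps S \<Longrightarrow> merge G T A \<in> cmps T"
  by (auto simp: components_of_def merge_comp)

lemma merge_merge: "S \<subseteq> T \<Longrightarrow> T \<subseteq> U \<Longrightarrow> A \<in> cmps S \<Longrightarrow> merge G U (merge G T A) = merge G U A"
  by (auto simp: components_of_def merge_comp)

text \<open>An edge with ends \<^term>\<open>u\<close> and \<^term>\<open>v\<close> joins the components of its ends and leaves the others
  alone.\<close>

lemma comp_insert:
  assumes "ends G e = Upair u v" "u \<in> V" "v \<in> V" "w \<in> V"
  shows "cmp (insert e S) w =
    (if cmp S w \<in> {cmp S u, cmp S v} then cmp S u \<union> cmp S v else cmp S w)"
proof -
  define R where "R = (adjacency G S)\<^sup>*"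
  have R: "\<And>x y. (x, y) \<in> R \<Longrightarrow> (y, x) \<in> R" "\<And>x. (x, x) \<in> R"
    "\<And>x y z. (x, y) \<in> R \<Longrightarrow> (y, z) \<in> R \<Longrightarrow> (x, z) \<in> R"
    using reach_sym by (auto simp: R_def intro: rtrancl_trans)
  have "adjacency G (insert e S) = insert (u, v) (insert (v, u) (adjacency G S))"
    using assms(1) by (auto simp: adjacency_def)
  then have reach: "(x, y) \<in> (adjacency G (insert e S))\<^sup>* \<longleftrightarrow>
      (x, y) \<in> R \<or> (x, u) \<in> R \<and> (v, y) \<in> R \<or> (x, v) \<in> R \<and> (u, y) \<in> R" for x y
    using R(3)[of x u y] R(3)[of x v y] R(2)[of u] R(2)[of v]
    unfolding R_def by (simp add: rtrancl_insert) argo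
  have shift: "(w, z) \<in> R \<longleftrightarrow> (x, z) \<in> R" if "(w, x) \<in> R" for x z
    using R(1,3) that by blast
  have in_AB: "cmp S w \<in> {cmp S u, cmp S v} \<longleftrightarrow> (w, u) \<in> R \<or> (w, v) \<in> R"
    using assms by (simp add: comp_eq_iff R_def)
  show ?thesis
  proof (cases "(w, u) \<in> R \<or> (w, v) \<in> R")
    case True
    then have "(w, z) \<in> R \<or> (w, u) \<in> R \<and> (v, z) \<in> R \<or> (w, v) \<in> R \<and> (u, z) \<in> R \<longleftrightarrow>
        (u, z) \<in> R \<or> (v, z) \<in> R" for z
      using shift[of u z] shift[of v z] by argo
    then have "cmp (insert e S) w = cmp S u \<union> cmp S v"
      unfolding component_of_def reach R_def[symmetric] by auto
    then show ?thesis using in_AB True by simp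
  next
    case False
    then have "cmp (insert e S) w = cmp S w"
      unfolding component_of_def reach R_def[symmetric] by auto
    then show ?thesis using in_AB False by simp
  qed
qed

subsection \<open>States as triples\<close>

lemma states_eq:
  "states G = (\<lambda>(S, X, Y). mk_state G S X Y) ` (SIGMA S:Pow E. Pow (cmps S) \<times> Pow S)"
proof (intro equalityI subsetI)
  fix s assume s: "s \<in> states G"
  let ?X = "{A \<in> cmps (sedges s). clabel s A = Some CompX}"
  let ?Y = "{e \<in> sedges s. elabel s e = Some EdgeY}"
  have dom: "dom (clabel s) = cmps (sedges s)" "dom (elabel s) = sedges s"
    using s by (auto simp: states_def)
  have "clabel s A = (if A \<in> cmps (sedges s) then Some (if A \<in> ?X then CompX else CompOne) else None)" for A
  proof (cases "clabel s A")
    case None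
    then show ?thesis using dom(1) by auto
  next
    case (Some l)
    then show ?thesis using dom(1) by (cases l) auto
  qed
  moreover have "elabel s e = (if e \<in> sedges s then Some (if e \<in> ?Y then EdgeY else EdgeOne) else None)" for e
  proof (cases "elabel s e")
    case None
    then show ?thesis using dom(2) by auto
  next
    case (Some l)
    then show ?thesis using dom(2) by (cases l) auto
  qed
  ultimately have "s = mk_state G (sedges s) ?X ?Y"
    unfolding mk_state_def by (intro state.equality) (auto simp: fun_eq_iff)
  moreover have "(sedges s, ?X, ?Y) \<in> (SIGMA S:Pow E. Pow (cmps S) \<times> Pow S)"
    using s by (auto simp: states_def)
  ultimately show "s \<in> (\<lambda>(S, X, Y). mk_state G S X Y) ` (SIGMA S:Pow E. Pow (cmps S) \<times> Pow S)"
    by (metis (mono_tags, lifting) case_prod_conv image_eqI)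
qed (auto simp: states_def mk_state_def dom_def split: if_splits)

lemma mk_state_labels:
  "sedges (mk_state G S X Y) = S"
  "Y \<subseteq> S \<Longrightarrow> {e \<in> S. elabel (mk_state G S X Y) e = Some EdgeY} = Y"
  "X \<subseteq> cmps S \<Longrightarrow> {A \<in> cmps S. clabel (mk_state G S X Y) A = Some CompX} = X"
  by (auto simp: mk_state_def)

lemma states_at_eq:
  "states_at G k i j = (\<lambda>(S, X, Y). mk_state G S X Y) `
     {(S, X, Y). S \<subseteq> E \<and> X \<subseteq> cmps S \<and> Y \<subseteq> S \<and> card S = k \<and> card Y = i \<and> card X = j}"
proof (intro equalityI subsetI)
  fix s assume "s \<in> states_at G k i j"
  then obtain S X Y where *: "S \<subseteq> E" "X \<subseteq> cmps S" "Y \<subseteq> S" and s: "s = mk_state G S X Y"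
    and "card (sedges s) = k" "card {e \<in> sedges s. elabel s e = Some EdgeY} = i"
      "card {A \<in> cmps (sedges s). clabel s A = Some CompX} = j"
    unfolding states_at_def states_eq by auto
  then have "card S = k" "card Y = i" "card X = j" by (simp_all add: mk_state_labels)
  with * have "(S, X, Y) \<in>
      {(S, X, Y). S \<subseteq> E \<and> X \<subseteq> cmps S \<and> Y \<subseteq> S \<and> card S = k \<and> card Y = i \<and> card X = j}" by simp
  from imageI[OF this, of "\<lambda>(S, X, Y). mk_state G S X Y"] s
  show "s \<in> (\<lambda>(S, X, Y). mk_state G S X Y) `
     {(S, X, Y). S \<subseteq> E \<and> X \<subseteq> cmps S \<and> Y \<subseteq> S \<and> card S = k \<and> card Y = i \<and> card X = j}" by simp
next
  fix s assume "s \<in> (\<lambda>(S, X, Y). mk_state G S X Y) `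
     {(S, X, Y). S \<subseteq> E \<and> X \<subseteq> cmps S \<and> Y \<subseteq> S \<and> card S = k \<and> card Y = i \<and> card X = j}"
  then show "s \<in> states_at G k i j"
    unfolding states_at_def states_eq
    by (auto simp: mk_state_labels intro!: image_eqI[where x = "(_, _, _)"])
qed

lemma inj_mk_state:
  "inj_on (\<lambda>(S, X, Y). mk_state G S X Y) (SIGMA S:Pow E. Pow (cmps S) \<times> Pow S)"
proof (rule inj_onI)
  fix p p' assume p: "p \<in> (SIGMA S:Pow E. Pow (cmps S) \<times> Pow S)"
    "p' \<in> (SIGMA S:Pow E. Pow (cmps S) \<times> Pow S)"
    and eq: "(\<lambda>(S, X, Y). mk_state G S X Y) p = (\<lambda>(S, X, Y). mk_state G S X Y) p'"
  obtain S X Y S' X' Y' where pq: "p = (S, X, Y)" "p' = (S', X', Y')" by (metis prod_cases3)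
  have sub: "X \<subseteq> cmps S" "Y \<subseteq> S" "X' \<subseteq> cmps S'" "Y' \<subseteq> S'"
    using p by (auto simp: pq)
  have eq': "mk_state G S X Y = mk_state G S' X' Y'" using eq by (simp add: pq)
  have S: "S = S'" using arg_cong[OF eq', of sedges] by (simp add: mk_state_labels(1))
  note eq' = eq'[unfolded S]
  have "X = X'"
    using mk_state_labels(3)[OF sub(1), of Y] mk_state_labels(3)[OF sub(3), of Y'] by (simp only: eq' S)
  moreover have "Y = Y'"
    using mk_state_labels(2)[OF sub(2), of X] mk_state_labels(2)[OF sub(4), of X'] by (simp only: eq' S)
  ultimately show "p = p'" using S by (simp add: pq)
qed

lemma finite_states: "finite (states G)"
  unfolding states_eq using finite_E finite_comps
  by (intro finite_imageI finite_SigmaI) (auto intro: finite_subset)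

lemma finite_states_at: "finite (states_at G k i j)"
  by (rule finite_subset[OF _ finite_states]) (auto simp: states_at_def)

section \<open>The differential\<close>

text \<open>Since \<open>x\<^sup>2 = 0\<close>, adding the edge \<open>e\<close> gives zero exactly if two components labeled \<open>x\<close> are joined,
  that is, if merging is not injective on \<^term>\<open>X\<close>; otherwise the components labeled \<open>x\<close> are the
  merged ones. This covers edges inside one component as well.\<close>

lemma partial_differential_mk_state:
  assumes S: "S \<subseteq> E" and e: "e \<in> E - S" and X: "X \<subseteq> cmps S" and Y: "Y \<subseteq> S"
  shows "partial_differential G e (mk_state G S X Y) =
    (if inj_on (merge G (insert e S)) X
     then frag_of (mk_state G (insert e S) (merge G (insert e S) ` X) Y) else 0)"
proof -
  obtain u v where uv: "end_pair G e = (u, v)" by fastforce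
  have "\<exists>p. case p of (u, v) \<Rightarrow> ends G e = Upair u v"
    by (metis case_prod_conv uprod_exhaust)
  from someI_ex[OF this] have ends: "ends G e = Upair u v"
    using uv unfolding end_pair_def by auto
  then have V: "u \<in> V" "v \<in> V"
    using fin e by (force simp: finite_multigraph_def)+
  define A where "A = cmp S u"
  define B where "B = cmp S v"
  have AB: "A \<in> cmps S" "B \<in> cmps S" using V by (auto simp: A_def B_def components_of_def)
  have cmp': "cmp (insert e S) w = (if cmp S w \<in> {A, B} then A \<union> B else cmp S w)"
    if "w \<in> V" for w
    unfolding A_def B_def by (rule comp_insert[OF ends V that])
  have merge: "merge G (insert e S) K = (if K \<in> {A, B} then A \<union> B else K)" if K: "K \<in> cmps S" for K
  proof -
    obtain w where w: "w \<in> V" "K = cmp S w" using K by (auto simp: components_of_def)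
    show ?thesis unfolding w(2) merge_comp[OF subset_insertI w(1)] by (rule cmp'[OF w(1)])
  qed
  have cmps': "cmps (insert e S) = insert (A \<union> B) (cmps S - {A, B})"
  proof (intro equalityI subsetI)
    fix K assume "K \<in> cmps (insert e S)"
    then obtain w where w: "w \<in> V" "K = cmp (insert e S) w" by (auto simp: components_of_def)
    then have "K = A \<union> B \<or> K = cmp S w \<and> K \<notin> {A, B}"
      using cmp'[of w] by (cases "cmp S w \<in> {A, B}") simp_all
    then show "K \<in> insert (A \<union> B) (cmps S - {A, B})"
      using w(1) unfolding components_of_def by blast
  next
    fix K assume "K \<in> insert (A \<union> B) (cmps S - {A, B})"
    then consider "K = A \<union> B" | "K \<in> cmps S" "K \<notin> {A, B}" by blast
    then show "K \<in> cmps (insert e S)"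
    proof cases
      case 1
      then have "K = cmp (insert e S) u" using cmp'[OF V(1)] by (simp add: A_def)
      then show ?thesis using V(1) by (auto simp: components_of_def)
    next
      case 2
      then obtain w where "w \<in> V" "K = cmp S w" by (auto simp: components_of_def)
      with 2 have "K = cmp (insert e S) w" using cmp' by auto
      then show ?thesis using \<open>w \<in> V\<close> by (auto simp: components_of_def)
    qed
  qed
  have elab: "(elabel (mk_state G S X Y))(e \<mapsto> EdgeOne) = elabel (mk_state G (insert e S) X' Y)" for X'
    using e Y by (auto simp: mk_state_def fun_eq_iff)
  have disj: "K = A" if "K \<in> cmps S" "K \<inter> A \<noteq> {}" "A \<in> cmps S" for K A
    using that comp_mem unfolding components_of_def by (metis (no_types, lifting) disjoint_iff imageE)
  have notin: "K \<in> {A, B}" if "K \<in> cmps S" "K = A \<union> B" for K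
    using disj[OF that(1) _ AB(1)] that(2) comp_self[OF V(1), of S] by (auto simp: A_def)
  show ?thesis
  proof (cases "A = B")
    case True
    have id: "merge G (insert e S) K = K" if "K \<in> cmps S" for K
      using merge[OF that] True by auto
    then have "inj_on (merge G (insert e S)) X" "merge G (insert e S) ` X = X"
      using X by (auto simp: inj_on_def subset_iff image_iff)
    moreover have "cmps (insert e S) = cmps S" using cmps' True AB by auto
    ultimately show ?thesis
      using True elab[of X]
      by (simp add: partial_differential_def Let_def uv A_def B_def mk_state_def)
  next
    case False
    have inj: "inj_on (merge G (insert e S)) X \<longleftrightarrow> \<not> (A \<in> X \<and> B \<in> X)"
    proof
      assume "inj_on (merge G (insert e S)) X"
      then show "\<not> (A \<in> X \<and> B \<in> X)"
        using False merge[OF AB(1)] merge[OF AB(2)] by (auto dest: inj_onD)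
    next
      assume *: "\<not> (A \<in> X \<and> B \<in> X)"
      show "inj_on (merge G (insert e S)) X"
      proof (rule inj_onI)
        fix K L assume KL: "K \<in> X" "L \<in> X" "merge G (insert e S) K = merge G (insert e S) L"
        then have in_S: "K \<in> cmps S" "L \<in> cmps S" using X by auto
        have eq: "(if K \<in> {A, B} then A \<union> B else K) = (if L \<in> {A, B} then A \<union> B else L)"
          using KL(3) unfolding merge[OF in_S(1)] merge[OF in_S(2)] .
        show "K = L"
        proof (cases "K \<in> {A, B}")
          case True
          moreover from this have "L \<in> {A, B}" using eq notin[OF in_S(2)] by metis
          ultimately show ?thesis using * KL by blast
        next
          case False
          moreover from this have "L \<notin> {A, B}" using eq notin[OF in_S(1)] by metis
          ultimately show ?thesis using eq by (simp only: if_False)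
        qed
      qed
    qed
    have img: "K \<in> merge G (insert e S) ` X \<longleftrightarrow>
        (if K = A \<union> B then A \<in> X \<or> B \<in> X else K \<in> X)" if K: "K \<in> cmps (insert e S)" for K
    proof -
      have "merge G (insert e S) ` X = (\<lambda>L. if L \<in> {A, B} then A \<union> B else L) ` X"
        using X merge by (intro image_cong refl) blast
      then have eq: "K \<in> merge G (insert e S) ` X \<longleftrightarrow> (\<exists>L\<in>X. K = (if L \<in> {A, B} then A \<union> B else L))"
        by (simp only: image_iff)
      show ?thesis
      proof (cases "K = A \<union> B")
        case True
        have "K = (if L \<in> {A, B} then A \<union> B else L) \<longleftrightarrow> L \<in> {A, B}" if L: "L \<in> X" for L
        proof (cases "L \<in> {A, B}")
          case False
          then have "K \<noteq> L" using notin[of L] L X True by blast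
          then show ?thesis unfolding if_not_P[OF False] using False by blast
        qed (use True in presburger)
        then have "K \<in> merge G (insert e S) ` X \<longleftrightarrow> (\<exists>L\<in>X. L \<in> {A, B})"
          unfolding eq by (rule bex_cong[OF refl])
        then show ?thesis unfolding if_P[OF True] by blast
      next
        case False
        then have "K \<notin> {A, B}" using K unfolding cmps' by blast
        then have "K = (if L \<in> {A, B} then A \<union> B else L) \<longleftrightarrow> K = L" for L
        proof (cases "L \<in> {A, B}")
          case in_AB: True
          then have "K \<noteq> L" using \<open>K \<notin> {A, B}\<close> by blast
          then show ?thesis unfolding if_P[OF in_AB] using False by blast
        qed presburger
        then have "K \<in> merge G (insert e S) ` X \<longleftrightarrow> (\<exists>L\<in>X. K = L)"
          unfolding eq by (rule bex_cong[OF refl])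
        then show ?thesis unfolding if_not_P[OF False] by blast
      qed
    qed
    define c where "c = (if A \<in> X \<or> B \<in> X then CompX else CompOne)"
    have mult: "label_mult (the (clabel (mk_state G S X Y) A)) (the (clabel (mk_state G S X Y) B))
        = (if A \<in> X \<and> B \<in> X then None else Some c)"
      using AB by (auto simp: mk_state_def c_def)
    have "(clabel (mk_state G S X Y))(A := None, B := None, A \<union> B \<mapsto> c) =
        clabel (mk_state G (insert e S) (merge G (insert e S) ` X) Y)"
    proof
      fix K
      have cl: "clabel (mk_state G T Z Y) K = (if K \<in> cmps T then Some (if K \<in> Z then CompX else CompOne) else None)"
        for T Z by (simp add: mk_state_def)
      consider "K = A \<union> B" | "K \<noteq> A \<union> B" "K \<in> {A, B}" "K \<notin> cmps (insert e S)"
        | "K \<noteq> A \<union> B" "K \<notin> {A, B}" "K \<in> cmps S" "K \<in> cmps (insert e S)"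
        | "K \<noteq> A \<union> B" "K \<notin> {A, B}" "K \<notin> cmps S" "K \<notin> cmps (insert e S)"
        using cmps' by blast
      then show "((clabel (mk_state G S X Y))(A := None, B := None, A \<union> B \<mapsto> c)) K =
        clabel (mk_state G (insert e S) (merge G (insert e S) ` X) Y) K"
      proof cases
        case 1
        then have "K \<in> cmps (insert e S)" using cmps' by blast
        from img[OF this] this show ?thesis unfolding cl by (simp add: 1 c_def)
      next
        case 3
        from img[OF 3(4)] 3 show ?thesis by (simp add: cl)
      qed (auto simp: cl)
    qed
    then have "\<lparr>sedges = insert e (sedges (mk_state G S X Y)),
         clabel = (clabel (mk_state G S X Y))(A := None, B := None, A \<union> B \<mapsto> c),
         elabel = (elabel (mk_state G S X Y))(e \<mapsto> EdgeOne)\<rparr> =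
        mk_state G (insert e S) (merge G (insert e S) ` X) Y"
      unfolding elab[of "merge G (insert e S) ` X"] by (simp add: mk_state_def)
    then show ?thesis
      using False mult unfolding inj
      by (simp add: partial_differential_def Let_def uv A_def B_def mk_state_labels(1))
  qed
qed

end

lemma sum_antisymmetric_frag:
  fixes h :: "'b \<Rightarrow> 'b \<Rightarrow> 'a \<Rightarrow>\<^sub>0 int"
  assumes "finite D" "\<And>e f. e \<in> D \<Longrightarrow> f \<in> D \<Longrightarrow> e \<noteq> f \<Longrightarrow> h f e = - h e f"
  shows "(\<Sum>e\<in>D. \<Sum>f\<in>D - {e}. h e f) = 0"
proof -
  let ?P = "{(e, f). e \<in> D \<and> f \<in> D \<and> e \<noteq> f}"
  let ?s = "\<Sum>(e, f)\<in>?P. h e f"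
  have "?s = (\<Sum>(f, e)\<in>?P. h e f)"
    by (rule sum.reindex_bij_witness[where i = prod.swap and j = prod.swap]) auto
  also have "\<dots> = (\<Sum>(f, e)\<in>?P. - h f e)"
    using assms(2) by (intro sum.cong) auto
  also have "\<dots> = - ?s" unfolding case_prod_unfold by (rule sum_negf)
  finally have neg: "?s = - ?s" .
  have "Poly_Mapping.lookup ?s t = 0" for t
    using arg_cong[OF neg, of "\<lambda>x. Poly_Mapping.lookup x t"] unfolding lookup_uminus by linarith
  then have "?s = 0" by (intro poly_mapping_eqI) (simp only: lookup_zero)
  moreover have "(\<Sum>e\<in>D. \<Sum>f\<in>D - {e}. h e f) = (\<Sum>(e, f)\<in>(SIGMA e:D. D - {e}). h e f)"
    using assms(1) by (intro sum.Sigma) auto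
  moreover have "(SIGMA e:D. D - {e}) = ?P" by auto
  ultimately show ?thesis by simp
qed

context fin_graph
begin

text \<open>The state \<open>(S, X, Y)\<close> carried to a larger subgraph \<^term>\<open>T\<close>: all edges of \<open>T - S\<close> are added at
  once, with label \<open>1\<close>, and the result is \<open>0\<close> if two components labeled \<open>x\<close> are joined.
  The subgraph \<open>S\<close> does not occur in the definition, since \<^term>\<open>merge G T\<close> depends
  only on \<^term>\<open>T\<close>. No order of adding the edges enters, so partial differentials
  commute.\<close>

definition push :: "'e set \<Rightarrow> 'v set set \<Rightarrow> 'e set \<Rightarrow> ('v, 'e) state \<Rightarrow>\<^sub>0 int" where
  "push T X Y = (if inj_on (merge G T) X then frag_of (mk_state G T (merge G T ` X) Y) else 0)"

text \<open>The sign with which the edge \<^term>\<open>e\<close> is added to \<^term>\<open>T\<close>. Only the case of \<^term>\<open>e\<close>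
  outside \<^term>\<open>T\<close> matters, where reflexivity of the order has no effect.\<close>

definition edge_sign :: "'e rel \<Rightarrow> 'e set \<Rightarrow> 'e \<Rightarrow> int" where
  "edge_sign r T e = (- 1) ^ card {f \<in> T. (f, e) \<in> r}"

lemma merge_id: "A \<in> cmps S \<Longrightarrow> merge G S A = A"
  by (auto simp: components_of_def merge_comp)

lemma push_self:
  assumes "X \<subseteq> cmps S"
  shows "push S X Y = frag_of (mk_state G S X Y)"
proof -
  have "inj_on (merge G S) X" "merge G S ` X = X"
    using assms by (auto simp: inj_on_def merge_id subset_iff image_iff)
  then show ?thesis by (simp add: push_def)
qed

text \<open>Adding edges in two stages is the same as adding them at once, because a composite
  \<open>merge G U \<circ> merge G T\<close> is injective on \<^term>\<open>X\<close> exactly if both stages are injective where they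
  apply.\<close>

lemma push_push:
  assumes "S \<subseteq> T" "T \<subseteq> U" "X \<subseteq> cmps S"
  shows "inj_on (merge G T) X \<Longrightarrow> push U (merge G T ` X) Y = push U X Y"
    and "\<not> inj_on (merge G T) X \<Longrightarrow> push U X Y = 0"
proof -
  have mm: "merge G U (merge G T A) = merge G U A" if "A \<in> X" for A
    using merge_merge[OF assms(1,2)] that assms(3) by blast
  have inj: "inj_on (merge G U) X \<longleftrightarrow> inj_on (merge G U \<circ> merge G T) X"
    by (rule inj_on_cong) (simp add: mm)
  have img: "merge G U ` merge G T ` X = merge G U ` X"
    unfolding image_image by (rule image_cong) (simp_all add: mm)
  show "push U (merge G T ` X) Y = push U X Y" if "inj_on (merge G T) X"
    unfolding push_def inj img using comp_inj_on_iff[OF that, of "merge G U"] by simp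
  show "push U X Y = 0" if "\<not> inj_on (merge G T) X"
    unfolding push_def inj using that by (auto dest: inj_on_imageI2)
qed

lemma differential_push:
  assumes "S \<subseteq> T" "T \<subseteq> E" "X \<subseteq> cmps S" "Y \<subseteq> S"
  shows "differential G r (push T X Y) =
    (\<Sum>e\<in>E - T. frag_cmul (edge_sign r T e) (push (insert e T) X Y))"
proof (cases "inj_on (merge G T) X")
  case True
  have "merge G T ` X \<subseteq> cmps T" "Y \<subseteq> T"
    using merge_in_comps[OF assms(1)] assms by auto
  then have "partial_differential G e (mk_state G T (merge G T ` X) Y) = push (insert e T) X Y"
    if "e \<in> E - T" for e
    using that partial_differential_mk_state[OF assms(2) that, of "merge G T ` X" Y]
      push_push(1)[OF assms(1) subset_insertI assms(3) True, of e Y]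
    by (simp add: push_def)
  then show ?thesis
    using True
    by (simp add: differential_def push_def[of T] state_differential_def mk_state_labels(1) edge_sign_def)
next
  case False
  then show ?thesis
    using push_push(2)[OF assms(1) subset_insertI assms(3) False]
    by (simp add: differential_def push_def[of T])
qed

text \<open>The double sum runs over ordered pairs of new edges; exchanging the two edges leaves the resulting
  state unchanged and reverses the sign.\<close>

lemma differential_differential_state:
  assumes r: "linear_order_on E r" and S: "S \<subseteq> E" "X \<subseteq> cmps S" "Y \<subseteq> S"
  shows "differential G r (differential G r (push S X Y)) = 0"
proof -
  define D where "D = E - S"
  define h where "h e f = frag_cmul (edge_sign r S e * edge_sign r (insert e S) f)
    (push (insert f (insert e S)) X Y)" for e f
  have finD: "finite D" using finite_E by (simp add: D_def)
  have finS: "finite S" using finite_E S(1) by (rule rev_finite_subset)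
  have "differential G r (differential G r (push S X Y)) =
      (\<Sum>e\<in>D. frag_cmul (edge_sign r S e) (differential G r (push (insert e S) X Y)))"
    unfolding differential_push[OF order_refl S] D_def[symmetric]
    using finD by (simp add: differential_def frag_extend_sum frag_extend_cmul o_def)
  also have "\<dots> = (\<Sum>e\<in>D. \<Sum>f\<in>D - {e}. h e f)"
  proof (intro sum.cong refl)
    fix e assume e: "e \<in> D"
    then have "differential G r (push (insert e S) X Y) =
      (\<Sum>f\<in>D - {e}. frag_cmul (edge_sign r (insert e S) f) (push (insert f (insert e S)) X Y))"
      using S differential_push[of S "insert e S" X Y r] unfolding D_def
      by (simp add: subset_insertI Diff_insert[symmetric])
    then show "frag_cmul (edge_sign r S e) (differential G r (push (insert e S) X Y)) =
        (\<Sum>f\<in>D - {e}. h e f)"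
      by (simp add: frag_cmul_sum h_def)
  qed
  also have "\<dots> = 0"
  proof (rule sum_antisymmetric_frag[OF finD])
    fix e f assume ef: "e \<in> D" "f \<in> D" "e \<noteq> f"
    \<comment> \<open>Adding \<open>a\<close> first changes the sign of \<open>b\<close> exactly if \<open>a\<close> precedes \<open>b\<close>.\<close>
    have sign: "edge_sign r (insert a S) b = (if (a, b) \<in> r then - 1 else 1) * edge_sign r S b"
      if "a \<in> D" for a b
    proof -
      have "{g \<in> insert a S. (g, b) \<in> r} =
          (if (a, b) \<in> r then insert a {g \<in> S. (g, b) \<in> r} else {g \<in> S. (g, b) \<in> r})"
        by auto
      moreover have "a \<notin> S" using that by (simp add: D_def)
      ultimately show ?thesis using finS by (simp add: edge_sign_def)
    qed
    have "(e, f) \<in> r \<longleftrightarrow> (f, e) \<notin> r"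
      using r ef by (auto simp: linear_order_on_def partial_order_on_def total_on_def D_def antisym_def)
    then show "h f e = - h e f"
      using ef by (simp add: h_def sign insert_commute[of e f] mult.commute flip: frag_cmul_minus_one)
  qed
  finally show ?thesis .
qed

lemma differential_differential:
  assumes r: "linear_order_on E r" and c: "c \<in> carrier (dichromatic_chains G k i j)"
  shows "differential G r (differential G r c) = 0"
proof -
  have "differential G r (state_differential G r s) = 0" if s: "s \<in> states_at G k i j" for s
  proof -
    obtain S X Y where "S \<subseteq> E" "X \<subseteq> cmps S" "Y \<subseteq> S" "s = mk_state G S X Y"
      using s unfolding states_at_eq by auto
    then show ?thesis
      using differential_differential_state[OF r, of S X Y] by (simp add: push_self differential_def)
  qed
  moreover have "Poly_Mapping.keys c \<subseteq> states_at G k i j" using c by (simp add: dichromatic_chains_def)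
  ultimately show ?thesis
    unfolding differential_def frag_extend_def[of _ c]
    by (simp add: frag_extend_sum frag_extend_cmul o_def subset_iff)
qed

lemma differential_hom:
  "differential G r \<in> hom (dichromatic_chains G k i j) (dichromatic_chains G (Suc k) i j)"
proof -
  have keys: "Poly_Mapping.keys (state_differential G r s) \<subseteq> states_at G (Suc k) i j"
    if s: "s \<in> states_at G k i j" for s
  proof -
    obtain S X Y where S: "S \<subseteq> E" "X \<subseteq> cmps S" "Y \<subseteq> S" "s = mk_state G S X Y"
      "card S = k" "card Y = i" "card X = j"
      using s unfolding states_at_eq by auto
    have "Poly_Mapping.keys (push (insert e S) X Y) \<subseteq> states_at G (Suc k) i j" if e: "e \<in> E - S" for e
    proof (cases "inj_on (merge G (insert e S)) X")
      case True
      have "merge G (insert e S) ` X \<subseteq> cmps (insert e S)"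
        using merge_in_comps[of S "insert e S"] S(2) by auto
      moreover have "card (merge G (insert e S) ` X) = j" using True S by (simp add: card_image)
      moreover have "card (insert e S) = Suc k"
        using e S finite_subset[OF S(1) finite_E] by simp
      ultimately have "mk_state G (insert e S) (merge G (insert e S) ` X) Y \<in> states_at G (Suc k) i j"
        unfolding states_at_eq using S e
        by (intro image_eqI[where x = "(insert e S, merge G (insert e S) ` X, Y)"]) auto
      then show ?thesis using True by (simp add: push_def)
    qed (simp add: push_def)
    moreover have "state_differential G r s =
        (\<Sum>e\<in>E - S. frag_cmul (edge_sign r S e) (push (insert e S) X Y))"
      using differential_push[OF order_refl S(1-3), of r] S by (simp add: push_self differential_def)
    ultimately show ?thesis
      by (auto dest!: subsetD[OF keys_sum] subsetD[OF keys_cmul])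
  qed
  have "Poly_Mapping.keys (differential G r c) \<subseteq> states_at G (Suc k) i j"
    if "Poly_Mapping.keys c \<subseteq> states_at G k i j" for c
    using keys that keys_frag_extend[of "state_differential G r" c]
    unfolding differential_def by blast
  then show ?thesis
    by (auto simp: hom_def dichromatic_chains_def differential_def frag_extend_add)
qed

text \<open>The Euler characteristic may be computed on chains, whose ranks count states.\<close>

theorem homology_euler_char_eq_card_states:
  assumes "linear_order_on E r"
  shows "homology_euler_char G r i j = (\<Sum>k\<le>card E. (- 1) ^ k * int (card (states_at G k i j)))"
proof -
  let ?C = "\<lambda>k. dichromatic_chains G k i j"
  have comm: "comm_group (?C k)" for k
    by (simp add: dichromatic_chains_def abelian_free_Abelian_group)
  have basis: "rational_basis (?C k) (frag_of ` states_at G k i j)" for k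
    unfolding dichromatic_chains_def by (rule rational_basis_free_Abelian_group[OF finite_states_at])
  have rank: "abelian_rank (?C k) = card (states_at G k i j)" for k
    using comm_group.abelian_rank_eq_card(1)[OF comm basis, of k]
    by (simp add: card_image inj_on_def frag_of_eq)
  have "states_at G (Suc (card E)) i j = {}"
  proof (rule equals0I)
    fix s assume "s \<in> states_at G (Suc (card E)) i j"
    then have "sedges s \<subseteq> E" "card (sedges s) = Suc (card E)"
      by (simp_all add: states_at_def states_def)
    then show False using card_mono[OF finite_E, of "sedges s"] by simp
  qed
  then have top: "carrier (?C (Suc (card E))) = {\<one>\<^bsub>?C (Suc (card E))\<^esub>}"
    by (auto simp: dichromatic_chains_def)
  have one: "\<one>\<^bsub>?C k\<^esub> = 0" for k by (simp add: dichromatic_chains_def)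
  have boundaries: "dichromatic_boundaries G r k i j =
      (case k of 0 \<Rightarrow> {\<one>\<^bsub>?C 0\<^esub>} | Suc k' \<Rightarrow> differential G r ` carrier (?C k'))" for k
    by (cases k) (simp_all add: dichromatic_boundaries_def one)
  have "differential G r (differential G r c) = \<one>\<^bsub>?C (Suc (Suc k))\<^esub>" if "c \<in> carrier (?C k)" for k c
    using differential_differential[OF assms that] by (simp add: one)
  note dd = this
  have ex_basis: "\<exists>A. rational_basis (?C k) A" for k using basis by blast
  from euler_characteristic_homology[of ?C "differential G r" "card E", OF comm ex_basis
      differential_hom dd top]
  show ?thesis
    unfolding homology_euler_char_def dichromatic_homology_def dichromatic_cycles_def boundaries rank .
qed

end

section \<open>Counting states and colorings\<close>

text \<open>Binomial inversion in the form of a sum over subsets; it passes from colorings with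
  prescribed monochromatic edges to colorings with exactly \<^term>\<open>i\<close> monochromatic edges.\<close>

lemma alternating_sum_Pow_choose:
  assumes "finite M"
  shows "(\<Sum>S\<in>Pow M. (- 1) ^ card S * int (card S choose i)) = (if card M = i then (- 1) ^ i else 0)"
  using assms
proof (induction M arbitrary: i rule: finite_induct)
  case empty
  then show ?case by (cases i) auto
next
  case (insert x M)
  have fin: "finite S" "x \<notin> S" if "S \<in> Pow M" for S
    using that insert.hyps finite_subset by auto
  have "(\<Sum>S\<in>Pow (insert x M). (- 1) ^ card S * int (card S choose i)) =
      (\<Sum>S\<in>Pow M. (- 1) ^ card S * int (card S choose i)) +
      (\<Sum>S\<in>insert x ` Pow M. (- 1) ^ card S * int (card S choose i))"
    unfolding Pow_insert using insert.hyps by (intro sum.union_disjoint) auto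
  also have "(\<Sum>S\<in>insert x ` Pow M. (- 1) ^ card S * int (card S choose i)) =
      (\<Sum>S\<in>Pow M. (- 1) ^ Suc (card S) * int (Suc (card S) choose i))"
  proof (subst sum.reindex)
    show "inj_on (insert x) (Pow M)"
      by (rule inj_onI) (use insert_ident[OF fin(2) fin(2)] in blast)
  qed (simp add: fin)
  also have "(\<Sum>S\<in>Pow M. (- 1) ^ card S * int (card S choose i)) + \<dots> =
      (\<Sum>S\<in>Pow M. (- 1) ^ card S * (int (card S choose i) - int (Suc (card S) choose i)))"
    by (simp add: sum.distrib[symmetric] algebra_simps)
  also have "\<dots> = (if card (insert x M) = i then (- 1) ^ i else 0)"
  proof (cases i)
    case (Suc i')
    have "(\<Sum>S\<in>Pow M. (- 1) ^ card S * (int (card S choose i) - int (Suc (card S) choose i))) =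
        - (\<Sum>S\<in>Pow M. (- 1) ^ card S * int (card S choose i'))"
      by (simp add: Suc sum_negf[symmetric])
    then show ?thesis using insert by (simp add: Suc)
  qed (use insert.hyps in simp)
  finally show ?case .
qed

lemma binomial_sum_atMost:
  fixes q :: int
  assumes "c \<le> N"
  shows "(\<Sum>j\<le>N. int (c choose j) * q ^ j) = (q + 1) ^ c"
proof -
  have "(\<Sum>j\<le>N. int (c choose j) * q ^ j) = (\<Sum>j\<le>c. int (c choose j) * q ^ j)"
    using assms by (intro sum.mono_neutral_right) (auto simp: binomial_eq_0)
  also have "\<dots> = (q + 1) ^ c" by (simp add: binomial_ring mult.commute)
  finally show ?thesis .
qed

lemma poly_eq_of_positive_naturals:
  fixes p q :: "int poly"
  assumes "\<And>n::nat. n \<ge> 1 \<Longrightarrow> poly p (int n) = poly q (int n)"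
  shows "p = q"
proof (rule ccontr)
  assume "p \<noteq> q"
  then have "finite {x. poly (p - q) x = 0}" by (intro poly_roots_finite) simp
  moreover have "int ` {1..} \<subseteq> {x. poly (p - q) x = 0}" using assms by auto
  ultimately have "finite (int ` {1..})" by (rule rev_finite_subset)
  then have "finite {1::nat..}" by (rule finite_imageD) simp
  then show False by (simp add: infinite_Ici)
qed

context fin_graph
begin

text \<open>The edges of the graph with both ends of the same color.\<close>

definition mono_edges :: "('v \<Rightarrow> nat) \<Rightarrow> 'e set" where
  "mono_edges f = {e \<in> E. monochromatic G f e}"

lemma monochromatic_iff: "ends G e = Upair u v \<Longrightarrow> monochromatic G f e \<longleftrightarrow> f u = f v"
  by (simp add: monochromatic_def) metis

lemma mono_edges_const_on_comps:
  assumes "S \<subseteq> mono_edges f" "v \<in> cmp S u"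
  shows "f v = f u"
proof -
  have "(u, v) \<in> (adjacency G S)\<^sup>*" using assms(2) by (simp add: component_of_def)
  then show ?thesis
  proof induction
    case (step v w)
    then obtain e where "e \<in> S" "ends G e = Upair v w" by (auto simp: adjacency_def)
    moreover from this have "f v = f w"
      using assms(1) monochromatic_iff[of e v w f] by (auto simp: mono_edges_def)
    ultimately show ?case using step.IH by simp
  qed simp
qed

text \<open>Colorings for which all edges of \<^term>\<open>S\<close> are monochromatic are the colorings of the set of
  components of \<^term>\<open>S\<close>.\<close>

lemma card_colorings_mono_on:
  assumes S: "S \<subseteq> E"
  shows "card {f \<in> V \<rightarrow>\<^sub>E {..<n}. S \<subseteq> mono_edges f} = n ^ card (cmps S)"
proof -
  let ?F = "\<lambda>g. \<lambda>v\<in>V. g (cmp S v)"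
  have "inj_on ?F (cmps S \<rightarrow>\<^sub>E {..<n})"
  proof (rule inj_onI)
    fix g h assume gh: "g \<in> cmps S \<rightarrow>\<^sub>E {..<n}" "h \<in> cmps S \<rightarrow>\<^sub>E {..<n}" and eq: "?F g = ?F h"
    show "g = h"
    proof (rule PiE_ext[OF gh])
      fix K assume "K \<in> cmps S"
      then obtain v where v: "v \<in> V" "K = cmp S v" by (auto simp: components_of_def)
      from fun_cong[OF eq, of v] show "g K = h K" using v by simp
    qed
  qed
  moreover have "?F ` (cmps S \<rightarrow>\<^sub>E {..<n}) = {f \<in> V \<rightarrow>\<^sub>E {..<n}. S \<subseteq> mono_edges f}"
  proof (intro equalityI subsetI)
    fix f assume "f \<in> ?F ` (cmps S \<rightarrow>\<^sub>E {..<n})"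
    then obtain g where g: "g \<in> cmps S \<rightarrow>\<^sub>E {..<n}" "f = ?F g" by blast
    have "f \<in> V \<rightarrow>\<^sub>E {..<n}" using g by (auto simp: components_of_def PiE_iff)
    moreover have "e \<in> mono_edges f" if e: "e \<in> S" for e
    proof -
      obtain u v where uv: "ends G e = Upair u v" by (rule uprod_exhaust)
      have V: "u \<in> V" "v \<in> V" using fin S e uv by (force simp: finite_multigraph_def)+
      have "(u, v) \<in> adjacency G S" using e uv by (auto simp: adjacency_def)
      then have "cmp S u = cmp S v" using comp_eq_iff[OF V] by blast
      then show ?thesis using V monochromatic_iff[OF uv] e S g(2) by (auto simp: mono_edges_def)
    qed
    ultimately show "f \<in> {f \<in> V \<rightarrow>\<^sub>E {..<n}. S \<subseteq> mono_edges f}" by blast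
  next
    fix f assume "f \<in> {f \<in> V \<rightarrow>\<^sub>E {..<n}. S \<subseteq> mono_edges f}"
    then have f: "f \<in> V \<rightarrow>\<^sub>E {..<n}" and mono: "S \<subseteq> mono_edges f" by auto
    let ?g = "\<lambda>K\<in>cmps S. f (SOME v. v \<in> K)"
    have g: "?g (cmp S v) = f v" if "v \<in> V" for v
    proof -
      have "(SOME w. w \<in> cmp S v) \<in> cmp S v" using comp_self[OF that] by (rule someI)
      then have "f (SOME w. w \<in> cmp S v) = f v" by (rule mono_edges_const_on_comps[OF mono])
      then show ?thesis using that by (simp add: components_of_def)
    qed
    have "?g K < n" if K: "K \<in> cmps S" for K
    proof -
      obtain v where "v \<in> V" "K = cmp S v" using K by (auto simp: components_of_def)
      then show ?thesis using g[of v] f by (auto simp: PiE_iff)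
    qed
    then have "?g \<in> cmps S \<rightarrow>\<^sub>E {..<n}" by auto
    moreover have "f = ?F ?g"
    proof
      fix v
      show "f v = ?F ?g v" using g[of v] f by (cases "v \<in> V") (auto simp: PiE_iff extensional_def)
    qed
    ultimately show "f \<in> ?F ` (cmps S \<rightarrow>\<^sub>E {..<n})" by blast
  qed
  ultimately have "bij_betw ?F (cmps S \<rightarrow>\<^sub>E {..<n}) {f \<in> V \<rightarrow>\<^sub>E {..<n}. S \<subseteq> mono_edges f}"
    by (simp add: bij_betw_def)
  from bij_betw_same_card[OF this, symmetric] show ?thesis
    by (simp add: card_PiE[OF finite_comps])
qed

text \<open>The subset expansion of the impropriety polynomial, evaluated at \<^term>\<open>n\<close>.\<close>

lemma card_improper_colorings:
  "(\<Sum>S\<in>Pow E. (- 1) ^ card S * int (card S choose i) * int n ^ card (cmps S)) =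
     (- 1) ^ i * int (card (improper_colorings G i n))"
proof -
  let ?F = "V \<rightarrow>\<^sub>E {..<n}"
  let ?w = "\<lambda>S. (- 1) ^ card S * int (card S choose i)"
  have finF: "finite ?F" using finite_V by (intro finite_PiE) auto
  have mono: "mono_edges f \<subseteq> E" for f by (auto simp: mono_edges_def)
  have "(\<Sum>S\<in>Pow E. ?w S * int n ^ card (cmps S)) =
      (\<Sum>S\<in>Pow E. \<Sum>f\<in>?F. if S \<subseteq> mono_edges f then ?w S else 0)"
  proof (intro sum.cong refl)
    fix S assume "S \<in> Pow E"
    then have "int n ^ card (cmps S) = int (card {f \<in> ?F. S \<subseteq> mono_edges f})"
      using card_colorings_mono_on[of S n] by simp
    then show "?w S * int n ^ card (cmps S) = (\<Sum>f\<in>?F. if S \<subseteq> mono_edges f then ?w S else 0)"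
      using finF by (simp add: sum.If_cases Int_def)
  qed
  also have "\<dots> = (\<Sum>f\<in>?F. \<Sum>S\<in>Pow E. if S \<subseteq> mono_edges f then ?w S else 0)"
    by (rule sum.swap)
  also have "\<dots> = (\<Sum>f\<in>?F. \<Sum>S\<in>Pow (mono_edges f). ?w S)"
  proof (rule sum.cong[OF refl])
    fix f
    have "Pow E \<inter> {S. S \<subseteq> mono_edges f} = Pow (mono_edges f)" using mono[of f] by auto
    then show "(\<Sum>S\<in>Pow E. if S \<subseteq> mono_edges f then ?w S else 0) = (\<Sum>S\<in>Pow (mono_edges f). ?w S)"
      using finite_E by (simp add: sum.If_cases)
  qed
  also have "\<dots> = (\<Sum>f\<in>?F. if card (mono_edges f) = i then (- 1) ^ i else 0)"
    using finite_subset[OF mono finite_E] by (intro sum.cong refl alternating_sum_Pow_choose) auto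
  also have "\<dots> = (- 1) ^ i * int (card (improper_colorings G i n))"
    using finF by (simp add: sum.If_cases Int_def improper_colorings_def mono_edges_def)
  finally show ?thesis .
qed

lemma card_states_at:
  "card (states_at G k i j) =
     (\<Sum>S | S \<in> Pow E \<and> card S = k. (card S choose i) * (card (cmps S) choose j))"
proof -
  let ?P = "{(S, X, Y). S \<subseteq> E \<and> X \<subseteq> cmps S \<and> Y \<subseteq> S \<and> card S = k \<and> card Y = i \<and> card X = j}"
  let ?Q = "SIGMA S:{S. S \<in> Pow E \<and> card S = k}.
      {X. X \<subseteq> cmps S \<and> card X = j} \<times> {Y. Y \<subseteq> S \<and> card Y = i}"
  have "card (states_at G k i j) = card ?P"
    unfolding states_at_eq
    by (intro card_image inj_on_subset[OF inj_mk_state]) auto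
  also have "?P = ?Q" by auto
  also have "card ?Q = (\<Sum>S | S \<in> Pow E \<and> card S = k.
      card ({X. X \<subseteq> cmps S \<and> card X = j} \<times> {Y. Y \<subseteq> S \<and> card Y = i}))"
    using finite_E finite_comps finite_subset[OF _ finite_E]
    by (intro card_SigmaI) auto
  also have "\<dots> = (\<Sum>S | S \<in> Pow E \<and> card S = k. (card S choose i) * (card (cmps S) choose j))"
    using finite_comps finite_subset[OF _ finite_E]
    by (intro sum.cong refl) (simp add: card_cartesian_product n_subsets mult.commute)
  finally show ?thesis .
qed

text \<open>Summing over the component labels of a subgraph with \<open>c\<close> components gives the binomial expansion of
  \<open>(q + 1)\<^sup>c\<close>; summing over its edge labels gives a binomial coefficient. No subgraph has more components
  than nodes, so the range of \<^term>\<open>j\<close> loses nothing.\<close>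

lemma sum_states_eq_subset_expansion:
  fixes q :: int
  shows "(\<Sum>j\<le>card V. (\<Sum>k\<le>card E. (- 1) ^ k * int (card (states_at G k i j))) * q ^ j) =
     (\<Sum>S\<in>Pow E. (- 1) ^ card S * int (card S choose i) * (q + 1) ^ card (cmps S))"
proof -
  have inner: "(\<Sum>k\<le>card E. (- 1) ^ k * int (card (states_at G k i j))) =
      (\<Sum>S\<in>Pow E. (- 1) ^ card S * int (card S choose i) * int (card (cmps S) choose j))" for j
  proof -
    have "(\<Sum>k\<le>card E. (- 1) ^ k * int (card (states_at G k i j))) =
        (\<Sum>k\<le>card E. \<Sum>S | S \<in> Pow E \<and> card S = k.
          (- 1) ^ card S * int (card S choose i) * int (card (cmps S) choose j))"
      unfolding card_states_at by (intro sum.cong refl) (simp add: sum_distrib_left mult.assoc)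
    also have "\<dots> = (\<Sum>S\<in>Pow E. (- 1) ^ card S * int (card S choose i) * int (card (cmps S) choose j))"
      using finite_E card_mono[OF finite_E] by (intro sum.group) auto
    finally show ?thesis .
  qed
  have "(\<Sum>j\<le>card V. (\<Sum>k\<le>card E. (- 1) ^ k * int (card (states_at G k i j))) * q ^ j) =
      (\<Sum>S\<in>Pow E. \<Sum>j\<le>card V. (- 1) ^ card S * int (card S choose i) * (int (card (cmps S) choose j) * q ^ j))"
    unfolding inner by (subst sum.swap) (simp add: sum_distrib_right mult.assoc)
  also have "\<dots> = (\<Sum>S\<in>Pow E. (- 1) ^ card S * int (card S choose i) * (q + 1) ^ card (cmps S))"
    unfolding sum_distrib_left[symmetric] by (simp add: binomial_sum_atMost[OF card_comps_le])
  finally show ?thesis .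
qed

lemma impropriety_poly_eq:
  assumes "\<And>j. \<chi> j = (\<Sum>k\<le>card E. (- 1) ^ k * int (card (states_at G k i j)))"
  shows "impropriety_poly G i = (- 1) ^ i * (\<Sum>j\<le>card V. smult (\<chi> j) ([:- 1, 1:] ^ j))"
    (is "_ = ?p")
proof -
  have val: "poly ?p (int n) = int (card (improper_colorings G i n))" for n
  proof -
    have "poly ?p (int n) = (- 1) ^ i * (\<Sum>j\<le>card V. \<chi> j * (int n - 1) ^ j)"
      by (simp add: poly_sum)
    also have "\<dots> = (- 1) ^ i * ((- 1) ^ i * int (card (improper_colorings G i n)))"
      unfolding assms sum_states_eq_subset_expansion card_improper_colorings[symmetric] by simp
    also have "\<dots> = int (card (improper_colorings G i n))"
      by (simp add: mult.assoc[symmetric] power_mult_distrib[symmetric])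
    finally show ?thesis .
  qed
  show ?thesis
    unfolding impropriety_poly_def
  proof (rule the_equality)
    show "\<forall>n\<ge>1. poly ?p (int n) = int (card (improper_colorings G i n))" using val by blast
    show "p = ?p" if "\<forall>n\<ge>1. poly p (int n) = int (card (improper_colorings G i n))" for p
      by (rule poly_eq_of_positive_naturals) (use that val in simp)
  qed
qed

end

theorem mainTheorem4:
  fixes G :: "('v, 'e) multigraph" and r :: "'e rel" and i :: nat
  assumes "finite_multigraph G"
    and "linear_order_on (edges G) r"
  shows "impropriety_poly G i =
    (- 1) ^ i * (\<Sum>j\<le>card (nodes G). smult (homology_euler_char G r i j) ([:- 1, 1:] ^ j))"
proof -
  interpret fin_graph G by unfold_locales (rule assms(1))
  show ?thesis
    by (rule impropriety_poly_eq) (rule homology_euler_char_eq_card_states[OF assms(2)])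
qed

end
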